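(* Let $\nu>-1$ and $q\in(0,1)$. Let $g_{\nu}^{(3)}(z;q)=c_{\nu}(q)z^{1-\nu}J_{\nu}^{(3)}(z;q)$. Then the radius of convexity $r^{c}\left(g_{\nu}^{(3)}(z;q)\right)$ of the function $z\mapsto g_{\nu}^{(3)}(z;q)$ is the smallest positive root of the equation (in $r$) $$(1-\nu)^2 J_{\nu}^{(3)}(r;q)+(3-2\nu)\,r\,\frac{dJ_{\nu}^{(3)}(r;q)}{dr}+r^2\frac{d^2J_{\nu}^{(3)}(r;q)}{dr^2}=0$$ and satisfies the following inequalities: $$\sqrt{\frac{\left(1-q^{\nu+1}\right)\left(1-q\right)}{9q}} <r^{c}\left(g_{\nu}^{(3)}(z;q)\right)<\sqrt{\frac{9(q^2-1)\left(1-q^{\nu+1}\right)\left(1-q^{\nu+2}\right)}{qY_{\nu}(q)}},$$ $$\sqrt[4]{\frac{(1+q)(1-q)^2\left(1-q^{\nu+1}\right)^2\left(q^{\nu+2}-1\right)}{q^2Y_{\nu}(q)}}<r^{c}\left(g_{\nu}^{(3)}(z;q)\right)<\sqrt{\frac{\left(1-q^{\nu+1}\right)\left(1-q^{\nu+3}\right)T(q)Y_{\nu}(q)}{3q(q+1)\left(\theta_{\nu}(q)+\varphi_{\nu}(q)\right)}},$$ where $$\theta_{\nu}(q)=261q-18q^{\nu+2}-504q^{\nu+3}-620q^{\nu+4}-504q^{\nu+5}-18q^{\nu+6}+67q^{2\nu+5},$$ $$\varphi_{\nu}(q)=261q^{2\nu+6}+261q^{2\nu+7}+243q^{2\nu+8}+67q^3+261q^2+243,$$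 $$Y_{\nu}(q)=81q^{\nu+3}+31q^{\nu+2}-31q-81,$$ $$T(q)=(q-1)(q^3+2q^2+2q+1).$$
   Context: For $q\in(0,1)$ and $a\in\mathbb{R}$: $(a;q)_0=1$, $(a;q)_n=\prod_{k=1}^{n}(1-aq^{k-1})$, $(a;q)_\infty=\prod_{k\ge1}(1-aq^{k-1})$. The Hahn-Exton $q$-Bessel function is, for $\nu>-1$, $$J_{\nu}^{(3)}(z;q)=\frac{(q^{\nu+1};q)_{\infty}}{(q;q)_{\infty}}\sum_{n\geq0}\frac{(-1)^{n}z^{2n+\nu}}{(q;q)_{n}(q^{\nu+1};q)_{n}}q^{\frac{1}{2}n(n+1)}.$$ Put $c_{\nu}(q)=(q;q)_{\infty}/(q^{\nu+1};q)_{\infty}$. The normalized function $g_\nu^{(3)}$ is understood as the entire function $$g_{\nu}^{(3)}(z;q)=c_{\nu}(q)z^{1-\nu}J_{\nu}^{(3)}(z;q)=\sum_{n\geq0}\frac{(-1)^nq^{\frac{1}{2}n(n+1)}}{(q;q)_{n}(q^{\nu+1};q)_{n}}z^{2n+1}.$$ With $\mathbb{D}_r=\{z\in\mathbb{C}:|z|<r\}$, the radius of convexity of an analytic function $f$ (with $f'(0)\neq0$) is $$r^{c}(f)=\sup\left\{r>0:\Re\left(1+\frac{zf''(z)}{f'(z)}\right)>0\text{ for all }z\in\mathbb{D}_r\right\}.$$ *)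

theory Defs
  imports "HOL-Analysis.Analysis"
begin

definition qpoch :: "real \<Rightarrow> real \<Rightarrow> nat \<Rightarrow> real" where
  "qpoch a q n = (\<Prod>k=1..n. 1 - a * q ^ (k - 1))"

definition qpoch_inf :: "real \<Rightarrow> real \<Rightarrow> real" where
  "qpoch_inf a q = (\<Prod>k. 1 - a * q ^ k)"

definition norm_const :: "real \<Rightarrow> real \<Rightarrow> real" where
  "norm_const \<nu> q = qpoch_inf q q / qpoch_inf (q powr (\<nu> + 1)) q"

(* One polymorphic definition gives the function of a positive real variable and, with the
   principal branch of the power, the function of a complex variable. As 0 powr a = 0 for
   every a, the value at the origin is not meaningful; only arguments z \<noteq> 0 are used. *)
definition hahn_exton_J :: "real \<Rightarrow> real \<Rightarrow> 'a \<Rightarrow> 'a::{ln, real_normed_field}" where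
  "hahn_exton_J \<nu> q z =
     of_real (qpoch_inf (q powr (\<nu> + 1)) q / qpoch_inf q q) *
     (\<Sum>n. of_real ((-1) ^ n / (qpoch q q n * qpoch (q powr (\<nu> + 1)) q n) * q ^ (n * (n + 1) div 2)) *
          z powr of_real (2 * real n + \<nu>))"

(* The entire extension of c z^(1-\<nu>) J(z); the identity on z \<noteq> 0 is the lemma
   hahn_exton_g_eq below. *)
definition hahn_exton_g :: "real \<Rightarrow> real \<Rightarrow> complex \<Rightarrow> complex" where
  "hahn_exton_g \<nu> q z =
     (\<Sum>n. of_real ((-1) ^ n * q ^ (n * (n + 1) div 2) /
                  (qpoch q q n * qpoch (q powr (\<nu> + 1)) q n)) * z ^ (2 * n + 1))"

(* The supremum is taken in the extended reals, so that it is meaningful for an unbounded set.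
   The condition f' \<noteq> 0 says that the quotient is defined: division by zero yields zero here,
   so without it a zero of f' would satisfy the inequality vacuously. *)
definition radius_of_convexity :: "(complex \<Rightarrow> complex) \<Rightarrow> ereal" where
  "radius_of_convexity f =
     Sup (ereal ` {r. r > 0 \<and> (\<forall>z. norm z < r \<longrightarrow>
            deriv f z \<noteq> 0 \<and> Re (1 + z * deriv (deriv f) z / deriv f z) > 0)})"

definition theta_fun :: "real \<Rightarrow> real \<Rightarrow> real" where
  "theta_fun \<nu> q = 261 * q - 18 * q powr (\<nu> + 2) - 504 * q powr (\<nu> + 3) - 620 * q powr (\<nu> + 4)
     - 504 * q powr (\<nu> + 5) - 18 * q powr (\<nu> + 6) + 67 * q powr (2 * \<nu> + 5)"

definition phi_fun :: "real \<Rightarrow> real \<Rightarrow> real" where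
  "phi_fun \<nu> q = 261 * q powr (2 * \<nu> + 6) + 261 * q powr (2 * \<nu> + 7) + 243 * q powr (2 * \<nu> + 8)
     + 67 * q ^ 3 + 261 * q ^ 2 + 243"

definition Y_fun :: "real \<Rightarrow> real \<Rightarrow> real" where
  "Y_fun \<nu> q = 81 * q powr (\<nu> + 3) + 31 * q powr (\<nu> + 2) - 31 * q - 81"

definition T_fun :: "real \<Rightarrow> real" where
  "T_fun q = (q - 1) * (q ^ 3 + 2 * q ^ 2 + 2 * q + 1)"

lemma qpoch_Suc: "qpoch a q (Suc n) = qpoch a q n * (1 - a * q ^ n)"
  by (simp add: qpoch_def)

lemma qpoch_factor_pos:
  assumes "0 < a" "a < 1" "0 < q" "q < 1"
  shows "1 - a * q ^ n > (0::real)" and "1 - a * q ^ n \<ge> 1 - a"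
proof -
  have "q ^ n \<le> 1" using assms by (simp add: power_le_one)
  then have "a * q ^ n \<le> a" using assms by (simp add: mult_left_le)
  then show "1 - a * q ^ n > 0" "1 - a * q ^ n \<ge> 1 - a" using assms by linarith+
qed

lemma qpoch_pos:
  assumes "0 < a" "a < 1" "0 < q" "q < 1"
  shows "qpoch a q n > 0"
  by (induction n) (use qpoch_factor_pos[OF assms] in \<open>auto simp: qpoch_Suc, simp add: qpoch_def\<close>)

lemma qpoch_inf_nonzero:
  assumes "0 < a" "a < 1" "0 < q" "q < 1"
  shows "qpoch_inf a q \<noteq> 0"
proof -
  have "summable (\<lambda>k. norm (1 - a * q ^ k - 1))"
    using assms by (simp add: abs_mult summable_mult summable_geometric)
  then have "convergent_prod (\<lambda>k. 1 - a * q ^ k)"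
    by (intro abs_convergent_prod_imp_convergent_prod summable_imp_abs_convergent_prod)
  then show ?thesis
    unfolding qpoch_inf_def
    using qpoch_factor_pos(1)[OF assms] by (intro prodinf_nonzero) (auto simp: less_le)
qed

lemma hahn_exton_g_summable:
  fixes z :: complex
  assumes "\<nu> > -1" "0 < q" "q < 1"
  shows "summable (\<lambda>n. of_real ((-1) ^ n * q ^ (n * (n + 1) div 2) /
                  (qpoch q q n * qpoch (q powr (\<nu> + 1)) q n)) * z ^ (2 * n + 1))"
    (is "summable ?f")
proof -
  define A where "A = q powr (\<nu> + 1)"
  have A: "0 < A" "A < 1"
    using assms by (auto simp: A_def powr01_less_one)
  define C where "C = (norm z)\<^sup>2 / ((1 - q) * (1 - A))"
  have C0: "C \<ge> 0" unfolding C_def using assms A by simp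
  have "(\<lambda>n. C * q ^ Suc n) \<longlonglongrightarrow> C * 0"
    using assms by (intro tendsto_mult tendsto_const LIMSEQ_Suc[OF LIMSEQ_power_zero]) auto
  then have "eventually (\<lambda>n. C * q ^ Suc n < 1/2) sequentially"
    by (intro order_tendstoD) auto
  then obtain N where N: "\<And>n. n \<ge> N \<Longrightarrow> C * q ^ Suc n < 1/2"
    unfolding eventually_sequentially by blast
  have step: "norm (?f (Suc n)) \<le> C * q ^ Suc n * norm (?f n)" for n
  proof -
    have e: "Suc n * (Suc n + 1) div 2 = n * (n + 1) div 2 + Suc n"
      by simp
    have p: "qpoch q q n > 0" "qpoch A q n > 0" "1 - q * q ^ n > 0" "1 - A * q ^ n > 0"
      using assms A qpoch_pos[of q q n] qpoch_pos[of A q n]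
        qpoch_factor_pos(1)[of q q n] qpoch_factor_pos(1)[of A q n] by auto
    have d: "(1 - q) * (1 - A) \<le> (1 - q * q ^ n) * (1 - A * q ^ n)"
      using assms A p by (intro mult_mono qpoch_factor_pos(2)) auto
    have d0: "(1 - q) * (1 - A) > 0" using assms A by simp
    define P where "P = q ^ (n * (n + 1) div 2) / (qpoch q q n * qpoch A q n) * norm z ^ (2 * n + 1)"
    have P: "P \<ge> 0" unfolding P_def using p assms by simp
    have nf: "norm (?f m) = q ^ (m * (m + 1) div 2) / (qpoch q q m * qpoch A q m) * norm z ^ (2 * m + 1)" for m
    proof -
      have "qpoch q q m > 0" "qpoch A q m > 0"
        using assms A by (auto intro: qpoch_pos)
      then show ?thesis
        unfolding A_def[symmetric] norm_mult norm_of_real norm_power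
        using assms by (simp add: abs_mult power_abs)
    qed
    have n1: "norm (?f n) = P" unfolding P_def nf ..
    have "norm (?f (Suc n)) = q ^ (n * (n + 1) div 2) * q ^ Suc n /
        ((qpoch q q n * (1 - q * q ^ n)) * (qpoch A q n * (1 - A * q ^ n))) *
        (norm z ^ (2 * n + 1) * (norm z)\<^sup>2)"
      unfolding nf[of "Suc n"] unfolding e qpoch_Suc by (simp add: power_add power2_eq_square)
    also have "\<dots> = q ^ Suc n * (norm z)\<^sup>2 / ((1 - q * q ^ n) * (1 - A * q ^ n)) * P"
      unfolding P_def by (simp add: ac_simps)
    also have "\<dots> \<le> q ^ Suc n * (norm z)\<^sup>2 / ((1 - q) * (1 - A)) * P"
      using d d0 P assms by (intro mult_right_mono divide_left_mono) auto
    also have "\<dots> = C * q ^ Suc n * norm (?f n)"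
      unfolding n1 C_def by simp
    finally show ?thesis .
  qed
  show ?thesis
  proof (rule summable_ratio_test[where c = "1/2" and N = N])
    fix n assume "N \<le> n"
    then have "C * q ^ Suc n * norm (?f n) \<le> 1/2 * norm (?f n)"
      using N[of n] by (intro mult_right_mono) auto
    then show "norm (?f (Suc n)) \<le> 1/2 * norm (?f n)"
      using step[of n] by linarith
  qed simp
qed

lemma hahn_exton_g_eq:
  fixes z :: complex
  assumes "\<nu> > -1" "0 < q" "q < 1" "z \<noteq> 0"
  shows "hahn_exton_g \<nu> q z = of_real (norm_const \<nu> q) * z powr of_real (1 - \<nu>) * hahn_exton_J \<nu> q z"
proof -
  define A where "A = q powr (\<nu> + 1)"
  have A: "0 < A" "A < 1"
    using assms by (auto simp: A_def powr01_less_one)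
  define a :: "nat \<Rightarrow> complex" where
    "a n = of_real ((-1) ^ n * q ^ (n * (n + 1) div 2) / (qpoch q q n * qpoch A q n))" for n
  define t where "t = (\<lambda>n. a n * z powr of_real (2 * real n + \<nu>))"
  have pw: "z powr of_real (1 - \<nu>) * z powr of_real (2 * real n + \<nu>) = z ^ (2 * n + 1)" for n
  proof -
    have "z powr of_real (1 - \<nu>) * z powr of_real (2 * real n + \<nu>)
        = z powr (of_real (1 - \<nu>) + of_real (2 * real n + \<nu>))"
      by (rule powr_add[symmetric])
    also have "of_real (1 - \<nu>) + of_real (2 * real n + \<nu>) = (of_nat (2 * n + 1) :: complex)"
      by simp
    also have "z powr of_nat (2 * n + 1) = z ^ (2 * n + 1)"
      using assms by (intro powr_nat') auto
    finally show ?thesis .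
  qed
  have nz: "z powr of_real (1 - \<nu>) \<noteq> 0" using assms by simp
  have s: "summable (\<lambda>n. z powr of_real (1 - \<nu>) * t n)"
    using hahn_exton_g_summable[OF assms(1-3), of z]
    unfolding t_def mult.left_commute[of "z powr of_real (1 - \<nu>)"] pw a_def A_def .
  then have "summable t" using nz by (simp add: summable_cmult_iff)
  then have "z powr of_real (1 - \<nu>) * suminf t = (\<Sum>n. z powr of_real (1 - \<nu>) * t n)"
    by (rule suminf_mult[symmetric])
  also have "\<dots> = hahn_exton_g \<nu> q z"
    unfolding t_def mult.left_commute[of "z powr of_real (1 - \<nu>)"] pw a_def A_def hahn_exton_g_def ..
  finally have g: "hahn_exton_g \<nu> q z = z powr of_real (1 - \<nu>) * suminf t" by simp
  have J: "hahn_exton_J \<nu> q z = of_real (qpoch_inf A q / qpoch_inf q q) * suminf t"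
    unfolding hahn_exton_J_def t_def a_def A_def by simp
  have "norm_const \<nu> q * (qpoch_inf A q / qpoch_inf q q) = 1"
    unfolding norm_const_def A_def[symmetric] using A assms by (simp add: qpoch_inf_nonzero)
  then have "of_real (norm_const \<nu> q) * of_real (qpoch_inf A q / qpoch_inf q q) = (1::complex)"
    by (metis of_real_mult of_real_1)
  then show ?thesis unfolding g J by (metis mult.assoc mult.commute mult_1)
qed

end

theory Submission
  imports Defs "HOL-Complex_Analysis.Cauchy_Integral_Formula"
    "HOL-Computational_Algebra.Fundamental_Theorem_Algebra"
begin

text \<open>
  Put \<open>w = z\<^sup>2\<close> and write \<open>g(z) = z F(w)\<close> with an entire function \<open>F\<close>. With the operator
  \<open>theta = 1 + 2 w d/dw\<close> one has \<open>g' = theta F\<close> and \<open>1 + z g''/g' = theta (theta F) / theta F\<close>, and the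
  Bessel-type equation for \<open>r\<close> says that \<open>D = theta (theta F)\<close> vanishes at \<open>r\<^sup>2\<close>. So the claim is that the
  radius of convexity is \<open>sqrt d\<close> for the smallest positive zero \<open>d\<close> of \<open>D\<close>, and that the
  Euler-Rayleigh estimates hold for \<open>d\<close>.

  Everything rests on the power sums of the reciprocal zeros, which are the coefficients of
  \<open>- G'/G\<close> for \<open>G = theta F\<close> and \<open>G = D\<close>, and on inequalities between these coefficients. The function
  \<open>F\<close> is the coefficientwise limit of rescaled Wall polynomials. Their zeros are positive by the
  three-term recurrence (\<open>pos_factored_wall_poly\<close>), the operator \<open>theta\<close> preserves this property
  (\<open>pos_factored_theta\<close>), and the power sums are continuous in the coefficients by Newton's
  identities. Hence the power sums of \<open>theta F\<close> and \<open>D\<close> satisfy the closed inequalities that hold for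
  finitely many positive numbers, among them nonnegativity and the Cauchy-Schwarz inequality
  (\<open>power_sum_bounds_hahn_exton\<close>).

  Nonnegativity alone yields the geometric part. If \<open>- G'/G\<close> has nonnegative coefficients and radius
  of convergence \<open>d\<close>, then \<open>|G(w)| \<ge> |G(|w|)| > 0\<close> for \<open>|w| < d\<close>, and \<open>G(d) = 0\<close>
  (\<open>zero_at_radius\<close>). Moreover \<open>theta G / G = 1 - 2 w (- G'/G)\<close> has its smallest real part on a circle at the
  positive real point (\<open>theta_quotient_pos\<close>), which identifies the radius of convexity.

  For the estimates, the Cauchy-Schwarz inequality makes the ratios of consecutive power sums
  increase, and they are bounded by \<open>1/d\<close>. Strictness comes from the rapid decay of the
  coefficients of \<open>D\<close>, which is incompatible with power sums forming a geometric
  sequence (\<open>power_sums_not_geometric\<close>, \<open>power_sum_estimates\<close>). Inserting the first three power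
  sums (\<open>zero_power_sum_values\<close>) gives the stated bounds.
\<close>

\<comment> \<open>This frees the infix \<open>$\<close> for the coefficients of power series.\<close>
unbundle no vec_syntax
unbundle fps_syntax

section \<open>Logarithmic derivatives of power series\<close>

text \<open>
  For a polynomial \<open>G = (1 - x\<^sub>1 X) \<dots> (1 - x\<^sub>m X)\<close> the coefficient of \<open>X\<^sup>n\<close> in \<open>- G' / G\<close> is the power sum
  \<open>\<Sum> x\<^sub>i\<^sup>n\<^sup>+\<^sup>1\<close> of the reciprocal zeros, and for a power series \<open>G\<close> the coefficients take the place of these sums.
\<close>
definition neg_log_deriv :: "real fps \<Rightarrow> real fps" where
  "neg_log_deriv G = - fps_deriv G / G"

lemma neg_log_deriv_eqI:
  assumes "G $ 0 = 1" "S * G = - fps_deriv G"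
  shows "neg_log_deriv G = S"
proof -
  have "G \<noteq> 0" using assms(1) by auto
  then show ?thesis unfolding neg_log_deriv_def assms(2)[symmetric] by simp
qed

lemma neg_log_deriv_mult_self:
  assumes "G $ 0 = 1"
  shows "neg_log_deriv G * G = - fps_deriv G"
proof -
  have "G * inverse G = 1" using assms by (simp add: inverse_mult_eq_1')
  moreover have "neg_log_deriv G = - fps_deriv G * inverse G"
    unfolding neg_log_deriv_def using assms by (simp add: fps_divide_unit)
  ultimately show ?thesis by (metis mult.assoc mult.commute mult_1)
qed

lemma neg_log_deriv_mult:
  assumes "G $ 0 = 1" "H $ 0 = 1"
  shows "neg_log_deriv (G * H) = neg_log_deriv G + neg_log_deriv H"
proof (rule neg_log_deriv_eqI)
  show "(neg_log_deriv G + neg_log_deriv H) * (G * H) = - fps_deriv (G * H)"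
  proof -
    have "(neg_log_deriv G + neg_log_deriv H) * (G * H) =
        (neg_log_deriv G * G) * H + (neg_log_deriv H * H) * G"
      by (simp add: algebra_simps)
    then show ?thesis
      unfolding neg_log_deriv_mult_self[OF assms(1)] neg_log_deriv_mult_self[OF assms(2)]
      by (simp add: algebra_simps)
  qed
qed (use assms in simp)

text \<open>
  Newton's identities. Each coefficient is a polynomial in finitely many coefficients of \<open>G\<close>; this
  gives continuity under coefficientwise limits, and the explicit first power sums later on.
\<close>
lemma neg_log_deriv_nth:
  assumes "G $ 0 = 1"
  shows "neg_log_deriv G $ n =
    - (real (Suc n) * G $ Suc n) - (\<Sum>i<n. neg_log_deriv G $ i * G $ (n - i))"
proof -
  have "(neg_log_deriv G * G) $ n = - (real (Suc n) * G $ Suc n)"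
    using neg_log_deriv_mult_self[OF assms] by simp
  moreover have "(neg_log_deriv G * G) $ n =
      neg_log_deriv G $ n + (\<Sum>i<n. neg_log_deriv G $ i * G $ (n - i))"
    unfolding fps_mult_nth using assms
    by (simp add: atLeast0AtMost lessThan_Suc_atMost[symmetric])
  ultimately show ?thesis by simp
qed

lemma neg_log_deriv_tendsto:
  assumes "\<And>N. G N $ 0 = 1" "H $ 0 = 1" "\<And>k. (\<lambda>N. G N $ k) \<longlonglongrightarrow> H $ k"
  shows "(\<lambda>N. neg_log_deriv (G N) $ n) \<longlonglongrightarrow> neg_log_deriv H $ n"
proof (induction n rule: less_induct)
  case (less n)
  show ?case
    unfolding neg_log_deriv_nth[OF assms(1), of _ n] neg_log_deriv_nth[OF assms(2), of n]
    by (intro tendsto_intros assms less.IH) auto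
qed

section \<open>Polynomials with positive zeros\<close>

definition linear_product :: "real list \<Rightarrow> real poly" where
  "linear_product xs = (\<Prod>x\<leftarrow>xs. [:1, - x:])"

definition pos_factored :: "real poly \<Rightarrow> bool" where
  "pos_factored p \<longleftrightarrow> (\<exists>xs. (\<forall>x\<in>set xs. 0 < x) \<and> p = linear_product xs)"

lemma linear_product_Nil [simp]: "linear_product [] = 1"
  and linear_product_Cons: "linear_product (x # xs) = [:1, - x:] * linear_product xs"
  by (simp_all add: linear_product_def)

lemma coeff_0_linear_product [simp]: "coeff (linear_product xs) 0 = 1"
  by (induction xs) (simp_all add: linear_product_Cons)

lemma neg_log_deriv_linear: "neg_log_deriv (fps_of_poly [:1, - x:]) $ n = x ^ Suc n"
proof -
  have "neg_log_deriv (fps_of_poly [:1, - x:]) = Abs_fps (\<lambda>n. x ^ Suc n)"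
  proof (rule neg_log_deriv_eqI)
    show "Abs_fps (\<lambda>n. x ^ Suc n) * fps_of_poly [:1, - x:] = - fps_deriv (fps_of_poly [:1, - x:])"
    proof (rule fps_ext)
      fix n
      show "(Abs_fps (\<lambda>n. x ^ Suc n) * fps_of_poly [:1, - x:]) $ n =
          (- fps_deriv (fps_of_poly [:1, - x:])) $ n"
        by (cases n) (simp_all add: fps_of_poly_pCons fps_of_poly_const algebra_simps)
    qed
  qed simp
  then show ?thesis by simp
qed

lemma neg_log_deriv_linear_product:
  "neg_log_deriv (fps_of_poly (linear_product xs)) $ n = (\<Sum>x\<leftarrow>xs. x ^ Suc n)"
proof (induction xs)
  case Nil
  then show ?case by (simp add: neg_log_deriv_def)
next
  case (Cons x xs)
  have "neg_log_deriv (fps_of_poly (linear_product (x # xs))) =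
      neg_log_deriv (fps_of_poly [:1, - x:]) + neg_log_deriv (fps_of_poly (linear_product xs))"
    unfolding linear_product_Cons fps_of_poly_mult by (rule neg_log_deriv_mult) simp_all
  then show ?case using Cons neg_log_deriv_linear[of x n] by simp
qed

text \<open>
  The inequalities between power sums \<open>s n = \<Sum> x\<^sub>i\<^sup>n\<^sup>+\<^sup>1\<close> of positive numbers that are used. All
  of them are closed conditions, so they survive limits in which the numbers \<open>x\<^sub>i\<close> themselves are lost.
  The second is the Cauchy-Schwarz inequality. The third follows from \<open>x\<^sub>i\<^sup>3 \<le> s 2\<close>; it will give the lower
  bounds for the smallest zero.
\<close>
definition power_sum_bounds :: "(nat \<Rightarrow> real) \<Rightarrow> bool" where
  "power_sum_bounds s \<longleftrightarrow> (\<forall>n. 0 \<le> s n \<and> (s (Suc n))\<^sup>2 \<le> s n * s (Suc (Suc n)) \<and>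
     s (Suc n) \<le> root 3 (s 2) * s n)"

lemma power_sum_bounds_tendsto:
  assumes "\<And>N. power_sum_bounds (s N)" "\<And>n. (\<lambda>N. s N n) \<longlonglongrightarrow> t n"
  shows "power_sum_bounds t"
  unfolding power_sum_bounds_def
proof (intro allI conjI)
  fix n
  show "0 \<le> t n"
    by (rule tendsto_lowerbound[OF assms(2)]) (use assms(1) in \<open>auto simp: power_sum_bounds_def\<close>)
  show "(t (Suc n))\<^sup>2 \<le> t n * t (Suc (Suc n))"
    by (rule LIMSEQ_le[of "\<lambda>N. (s N (Suc n))\<^sup>2" _ "\<lambda>N. s N n * s N (Suc (Suc n))"])
      (use assms(1) in \<open>auto simp: power_sum_bounds_def intro!: tendsto_intros assms(2)\<close>)
  show "t (Suc n) \<le> root 3 (t 2) * t n"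
    by (rule LIMSEQ_le[of "\<lambda>N. s N (Suc n)" _ "\<lambda>N. root 3 (s N 2) * s N n"])
      (use assms(1) in \<open>auto simp: power_sum_bounds_def intro!: tendsto_intros assms(2)\<close>)
qed

lemma power_sum_bounds_list:
  fixes xs :: "real list"
  assumes "\<forall>x\<in>set xs. 0 < x"
  shows "power_sum_bounds (\<lambda>n. \<Sum>x\<leftarrow>xs. x ^ Suc n)"
  unfolding power_sum_bounds_def
proof (intro allI conjI)
  fix n
  let ?s = "\<lambda>n. \<Sum>x\<leftarrow>xs. x ^ Suc n"
  have pos: "0 < xs ! i" if "i < length xs" for i using assms that by simp
  have S: "?s m = (\<Sum>i<length xs. (xs ! i) ^ Suc m)" for m
    by (simp add: sum_list_sum_nth atLeast0LessThan)
  show "0 \<le> ?s n" unfolding S using pos by (intro sum_nonneg) (simp add: less_imp_le)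
  \<comment> \<open>Cauchy-Schwarz for the vectors with entries \<open>x\<^sub>i\<^bsup>(n+1)/2\<^esup>\<close> and \<open>x\<^sub>i\<^bsup>(n+3)/2\<^esup>\<close>.\<close>
  have "(\<Sum>i<length xs. sqrt ((xs ! i) ^ Suc n) * (sqrt ((xs ! i) ^ Suc n) * xs ! i))\<^sup>2 \<le>
      (\<Sum>i<length xs. (sqrt ((xs ! i) ^ Suc n))\<^sup>2) * (\<Sum>i<length xs. (sqrt ((xs ! i) ^ Suc n) * xs ! i)\<^sup>2)"
    by (rule Cauchy_Schwarz_ineq_sum)
  moreover have "(\<Sum>i<length xs. sqrt ((xs ! i) ^ Suc n) * (sqrt ((xs ! i) ^ Suc n) * xs ! i)) = ?s (Suc n)"
    unfolding S
  proof (rule sum.cong)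
    fix i assume "i \<in> {..<length xs}"
    then have "0 \<le> (xs ! i) ^ Suc n" using pos[of i] by simp
    then have "sqrt ((xs ! i) ^ Suc n) * sqrt ((xs ! i) ^ Suc n) = (xs ! i) ^ Suc n"
      by (metis real_sqrt_mult_self abs_of_nonneg)
    then show "sqrt ((xs ! i) ^ Suc n) * (sqrt ((xs ! i) ^ Suc n) * xs ! i) = (xs ! i) ^ Suc (Suc n)"
      by (metis mult.assoc mult.commute power_Suc)
  qed simp
  moreover have "(\<Sum>i<length xs. (sqrt ((xs ! i) ^ Suc n))\<^sup>2) = ?s n"
    unfolding S by (intro sum.cong) (use pos in \<open>auto simp: less_imp_le\<close>)
  moreover have "(\<Sum>i<length xs. (sqrt ((xs ! i) ^ Suc n) * xs ! i)\<^sup>2) = ?s (Suc (Suc n))"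
    unfolding S by (intro sum.cong) (use pos in \<open>auto simp: less_imp_le power_mult_distrib power2_eq_square\<close>)
  ultimately show "(?s (Suc n))\<^sup>2 \<le> ?s n * ?s (Suc (Suc n))" by simp
  have "xs ! i \<le> root 3 (?s 2)" if "i < length xs" for i
  proof -
    have "(xs ! i) ^ 3 \<le> ?s 2"
      unfolding S using that pos
      by (intro order_trans[OF _ member_le_sum[of i]]) (auto simp: less_imp_le numeral_3_eq_3)
    then have "root 3 ((xs ! i) ^ 3) \<le> root 3 (?s 2)" by simp
    then show ?thesis using pos[OF that] by (simp add: real_root_power_cancel)
  qed
  then show "?s (Suc n) \<le> root 3 (?s 2) * ?s n"
    unfolding S[of n] S[of "Suc n"] sum_distrib_left using pos
    by (intro sum_mono) (auto intro!: mult_right_mono simp: less_imp_le)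
qed

lemma power_sum_bounds_pos_factored:
  "pos_factored p \<Longrightarrow> power_sum_bounds (fps_nth (neg_log_deriv (fps_of_poly p)))"
  unfolding pos_factored_def
proof safe
  fix xs :: "real list" assume "\<forall>x\<in>set xs. 0 < x"
  moreover have "fps_nth (neg_log_deriv (fps_of_poly (linear_product xs))) = (\<lambda>n. \<Sum>x\<leftarrow>xs. x ^ Suc n)"
    by (rule ext) (rule neg_log_deriv_linear_product)
  ultimately show "power_sum_bounds (fps_nth (neg_log_deriv (fps_of_poly (linear_product xs))))"
    using power_sum_bounds_list by simp
qed

definition ceval :: "real poly \<Rightarrow> complex \<Rightarrow> complex" where
  "ceval p z = poly (map_poly of_real p) z"

lemma ceval_0 [simp]: "ceval 0 z = 0"
  and ceval_pCons [simp]: "ceval (pCons a p) z = of_real a + z * ceval p z"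
  by (simp_all add: ceval_def map_poly_pCons)

lemma ceval_1 [simp]: "ceval 1 z = 1"
  unfolding one_pCons by simp

lemma ceval_add [simp]: "ceval (p + r) z = ceval p z + ceval r z"
  by (induction p r rule: poly_induct2) (simp_all add: algebra_simps)

lemma ceval_smult [simp]: "ceval (smult a p) z = of_real a * ceval p z"
  by (induction p) (simp_all add: algebra_simps)

lemma ceval_mult [simp]: "ceval (p * r) z = ceval p z * ceval r z"
  by (induction p) (simp_all add: algebra_simps)

lemma ceval_of_real: "ceval p (of_real x) = of_real (poly p x)"
  by (induction p) simp_all

lemma pos_factoredI:
  assumes "poly p 0 = 1" "\<And>z. ceval p z = 0 \<Longrightarrow> Im z = 0 \<and> 0 < Re z"
  shows "pos_factored p"
  using assms
proof (induction "degree p" arbitrary: p)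
  case 0
  then obtain c where c: "p = [:c:]" by (metis degree_eq_zeroE)
  with 0 have "p = 1" by simp
  then show ?case unfolding pos_factored_def by (intro exI[of _ "[]"]) simp
next
  case (Suc d)
  have "degree (map_poly of_real p :: complex poly) = Suc d"
    using Suc.hyps(2) by (simp add: degree_map_poly)
  then obtain z :: complex where "poly (map_poly of_real p) z = 0"
    using fundamental_theorem_of_algebra by (metis constant_degree nat.distinct(1))
  then have z: "ceval p z = 0" by (simp add: ceval_def)
  define a where "a = Re z"
  have a: "0 < a" "z = of_real a"
    using Suc.prems(2)[OF z] by (auto simp: a_def complex_eq_iff)
  then have "poly p a = 0" using z by (simp add: ceval_of_real)
  then have "[:- a, 1:] dvd p" by (simp add: poly_eq_0_iff_dvd)
  then obtain r where "p = [:- a, 1:] * r" by blast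
  moreover have "[:- a, 1:] = smult (- a) [:1, - (1 / a):]" using a by simp
  ultimately have p: "p = [:1, - (1 / a):] * smult (- a) r" by (metis mult_smult_left mult_smult_right)
  define t where "t = smult (- a) r"
  have p: "p = [:1, - (1 / a):] * t" unfolding t_def by (rule p)
  have "t \<noteq> 0" using p Suc.prems(1) by auto
  then have "degree p = 1 + degree t"
    unfolding p using a by (subst degree_mult_eq) auto
  then have d: "d = degree t" using Suc.hyps(2) by simp
  have "pos_factored t"
  proof (rule Suc.hyps(1)[OF d])
    show "poly t 0 = 1" using Suc.prems(1) p by simp
    show "Im z = 0 \<and> 0 < Re z" if "ceval t z = 0" for z
      by (rule Suc.prems(2)) (simp add: p that del: mult_pCons_left)
  qed
  then obtain xs where "\<forall>x\<in>set xs. 0 < x" "t = linear_product xs" by (auto simp: pos_factored_def)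
  then show ?case unfolding pos_factored_def using a p
    by (intro exI[of _ "1 / a # xs"]) (auto simp: linear_product_Cons)
qed

text \<open>
  Substituting \<open>c X\<close> for \<open>X\<close> multiplies every \<open>x\<^sub>i\<close> by \<open>c\<close>.
\<close>
lemma pos_factored_rescale:
  assumes "pos_factored p" "0 < c"
  shows "pos_factored (pcompose p [:0, c:])"
proof -
  have "pcompose [:1, - x:] [:0, c:] = [:1, - (c * x):]" for x
    by (simp add: pcompose_pCons)
  then have "pcompose (linear_product xs) [:0, c:] = linear_product (map ((*) c) xs)" for xs
    by (induction xs) (simp_all add: linear_product_Cons pcompose_mult pcompose_1 del: mult_pCons_left)
  then show ?thesis using assms unfolding pos_factored_def
    by (metis (no_types, lifting) image_iff list.set_map mult_pos_pos)
qed

text \<open>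
  The operator \<open>1 + 2 w d/dw\<close>, in the variable \<open>w = z\<^sup>2\<close>: if \<open>g(z) = z p(z\<^sup>2)\<close>, then
  \<open>g'(z) = (theta p)(z\<^sup>2)\<close>, and \<open>(z g'(z))' = (theta (theta p))(z\<^sup>2)\<close>.
\<close>
definition theta_poly :: "real poly \<Rightarrow> real poly" where
  "theta_poly p = p + [:0, 2:] * pderiv p"

lemma sum_list_pos:
  fixes f :: "'a \<Rightarrow> real"
  assumes "\<And>x. x \<in> set xs \<Longrightarrow> 0 < f x" "xs \<noteq> []"
  shows "0 < (\<Sum>x\<leftarrow>xs. f x)"
  using assms(2,1) by (induction xs rule: list_nonempty_induct) (auto intro: add_pos_pos)

lemma ceval_linear_product_Cons:
  "ceval (linear_product (x # xs)) z = (1 - of_real x * z) * ceval (linear_product xs) z"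
  unfolding linear_product_Cons ceval_mult by simp

lemma ceval_linear_product_nz:
  assumes "\<forall>x\<in>set xs. 1 - of_real x * z \<noteq> 0"
  shows "ceval (linear_product xs) z \<noteq> 0"
  using assms by (induction xs) (simp_all add: ceval_linear_product_Cons)

lemma ceval_pderiv_linear_product:
  assumes "\<forall>x\<in>set xs. 1 - of_real x * z \<noteq> 0"
  shows "ceval (pderiv (linear_product xs)) z =
    - ceval (linear_product xs) z * (\<Sum>x\<leftarrow>xs. of_real x / (1 - of_real x * z))"
  using assms
proof (induction xs)
  case Nil
  then show ?case by (simp add: pderiv_1)
next
  case (Cons x xs)
  then have nz: "1 - of_real x * z \<noteq> 0" by simp
  let ?P = "ceval (linear_product xs) z" and ?S = "\<Sum>x\<leftarrow>xs. of_real x / (1 - of_real x * z)"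
  have "pderiv [:1, - x:] = [:- x:]" by (simp add: pderiv_pCons)
  then have "ceval (pderiv (linear_product (x # xs))) z =
      (1 - of_real x * z) * ceval (pderiv (linear_product xs)) z - of_real x * ?P"
    unfolding linear_product_Cons pderiv_mult ceval_add ceval_mult by (simp add: algebra_simps)
  also have "\<dots> = - ((1 - of_real x * z) * ?P) * (of_real x / (1 - of_real x * z) + ?S)"
    using Cons nz by (simp add: field_simps)
  finally show ?case by (simp add: ceval_linear_product_Cons)
qed

text \<open>
  An instance of Laguerre's theorem. If \<open>p\<close> has no zero at \<open>w\<close>, then
  \<open>(theta p)(w) = p(w) (1 - 2 \<Sum> x\<^sub>i w / (1 - x\<^sub>i w))\<close>. For nonreal \<open>w\<close> the imaginary parts of the summands
  have the sign of \<open>Im w\<close>, and for \<open>w \<le> 0\<close> the summands are nonpositive; in neither case can the sum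
  be \<open>1/2\<close>.
\<close>
lemma pos_factored_theta:
  assumes "pos_factored p"
  shows "pos_factored (theta_poly p)"
proof -
  obtain xs where xs: "\<forall>x\<in>set xs. 0 < x" "p = linear_product xs"
    using assms by (auto simp: pos_factored_def)
  show ?thesis
  proof (rule pos_factoredI)
    show "poly (theta_poly p) 0 = 1"
      by (simp add: theta_poly_def xs poly_0_coeff_0)
    fix z assume z0: "ceval (theta_poly p) z = 0"
    show "Im z = 0 \<and> 0 < Re z"
    proof (rule ccontr)
      assume z: "\<not> (Im z = 0 \<and> 0 < Re z)"
      have nz: "1 - of_real x * z \<noteq> 0" if "x \<in> set xs" for x
      proof
        assume "1 - of_real x * z = 0"
        then have "z = of_real (1 / x)" using xs(1) that by (auto simp: field_simps)
        then show False using z xs(1) that by simp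
      qed
      define f where "f = (\<lambda>x. of_real x * z / (1 - of_real x * z))"
      have "ceval (theta_poly p) z = ceval p z * (1 - 2 * (z * (\<Sum>x\<leftarrow>xs. of_real x / (1 - of_real x * z))))"
        using nz unfolding theta_poly_def xs(2)
        by (simp add: ceval_pderiv_linear_product algebra_simps)
      also have "z * (\<Sum>x\<leftarrow>xs. of_real x / (1 - of_real x * z)) = (\<Sum>x\<leftarrow>xs. f x)"
        unfolding f_def by (induction xs) (simp_all add: algebra_simps)
      finally have "ceval p z * (1 - 2 * (\<Sum>x\<leftarrow>xs. f x)) = 0" using z0 by simp
      moreover have "ceval p z \<noteq> 0" using nz xs(2) by (simp add: ceval_linear_product_nz)
      ultimately have half: "(\<Sum>x\<leftarrow>xs. f x) = 1 / 2" by (simp add: mult.commute)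
      have f: "f x = (of_real x * z - of_real (x\<^sup>2 * (norm z)\<^sup>2)) / of_real ((norm (1 - of_real x * z))\<^sup>2)" for x
        unfolding f_def complex_div_cnj[of _ "1 - of_real x * z"] of_real_mult complex_norm_square
        by (simp add: algebra_simps power2_eq_square)
      show False
      proof (cases "Im z = 0")
        case True
        have "Re (f x) \<le> 0" if "x \<in> set xs" for x
        proof -
          have "x * Re z \<le> 0" using True z xs(1) that by (intro mult_nonneg_nonpos) (auto simp: less_imp_le)
          moreover have "Re (of_real x * z - of_real (x\<^sup>2 * (norm z)\<^sup>2)) = x * Re z - (x * norm z)\<^sup>2"
            by (simp add: power_mult_distrib)
          moreover have "0 \<le> (x * norm z)\<^sup>2" by simp
          ultimately have "Re (of_real x * z - of_real (x\<^sup>2 * (norm z)\<^sup>2)) \<le> 0" by linarith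
          then show ?thesis unfolding f Re_divide_of_real by (intro divide_nonpos_nonneg) auto
        qed
        then have "(\<Sum>x\<leftarrow>xs. Re (f x)) \<le> 0" by (intro sum_list_nonpos) auto
        moreover have "(\<Sum>x\<leftarrow>xs. Re (f x)) = Re (\<Sum>x\<leftarrow>xs. f x)" by (induction xs) simp_all
        ultimately show False using half by simp
      next
        case False
        have "Im (f x) / Im z > 0" if "x \<in> set xs" for x
          unfolding f Im_divide_of_real using xs(1) that nz[OF that] False by simp
        moreover have "xs \<noteq> []" using half by auto
        ultimately have "(\<Sum>x\<leftarrow>xs. Im (f x) / Im z) > 0"
          by (intro sum_list_pos) auto
        moreover have "(\<Sum>x\<leftarrow>xs. Im (f x) / Im z) = Im (\<Sum>x\<leftarrow>xs. f x) / Im z"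
          by (induction xs) (simp_all add: add_divide_distrib)
        ultimately show False using half by simp
      qed
    qed
  qed
qed

section \<open>Wall polynomials\<close>

text \<open>
  The Wall (little \<open>q\<close>-Laguerre) polynomials, with the parameter normalized so that \<open>A\<close> is the base of the
  \<open>q\<close>-shifted factorial in the denominator. They are orthogonal on the positive half-line for
  \<open>0 < A < 1\<close>, which is why their zeros are positive; the orthogonality enters in the form of the
  three-term recurrence \<open>wall_poly_recurrence\<close>.
\<close>
definition wall_coeff :: "real \<Rightarrow> real \<Rightarrow> nat \<Rightarrow> nat \<Rightarrow> real" where
  "wall_coeff A q n k = qpoch (1 / q ^ n) q k * q ^ k / (qpoch A q k * qpoch q q k)"

definition wall_poly :: "real \<Rightarrow> real \<Rightarrow> nat \<Rightarrow> real poly" where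
  "wall_poly A q n = (\<Sum>k\<le>n. monom (wall_coeff A q n k) k)"

lemma qpoch_0 [simp]: "qpoch a q 0 = 1"
  by (simp add: qpoch_def)

lemma qpoch_Suc_shift: "qpoch a q (Suc k) = (1 - a) * qpoch (a * q) q k"
  by (induction k) (simp_all add: qpoch_Suc ac_simps)

text \<open>
  The series defining the polynomial terminates by itself, so that one formula gives all coefficients.
\<close>
lemma qpoch_eq_0:
  assumes "q \<noteq> 0" "n < k"
  shows "qpoch (1 / q ^ n) q k = 0"
  unfolding qpoch_def using assms by (intro prod_zero) (auto intro!: bexI[of _ "Suc n"])

lemma coeff_wall_poly:
  assumes "q \<noteq> 0"
  shows "coeff (wall_poly A q n) k = wall_coeff A q n k"
proof -
  have "coeff (wall_poly A q n) k = (if k \<le> n then wall_coeff A q n k else 0)"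
    unfolding wall_poly_def coeff_sum coeff_monom by simp
  then show ?thesis using qpoch_eq_0[OF assms, of n k] by (simp add: wall_coeff_def)
qed

definition wall_up :: "real \<Rightarrow> real \<Rightarrow> nat \<Rightarrow> real" where
  "wall_up A q n = q ^ n * (1 - A * q ^ n)"

definition wall_down :: "real \<Rightarrow> real \<Rightarrow> nat \<Rightarrow> real" where
  "wall_down A q n = A / q * q ^ n * (1 - q ^ n)"

text \<open>
  The recurrence for the coefficients of index \<open>k = j + 1\<close>, divided by the common factor of the terms. Here
  \<open>y = q\<^sup>-\<^sup>n\<close> (with \<open>n\<close> the middle degree) and \<open>u = q\<^sup>j\<close> are treated as independent variables.
\<close>
lemma wall_coeff_identity:
  fixes y q u A :: real
  assumes "y \<noteq> 0" "q \<noteq> 0"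
  shows "q * (1 / y * (1 - A / y) * (1 - y / q) - (1 / y * (1 - A / y) - A / (q * y\<^sup>2) * (1 - y)) * (1 - y * u)
     - A / (q * y\<^sup>2) * (1 - y * u) * (1 - y * u * q)) = - (1 - A * u) * (1 - u * q)"
  using assms by (simp add: divide_simps power2_eq_square) (simp add: algebra_simps)

lemma wall_coeff_recurrence:
  assumes "0 < A" "A < 1" "0 < q" "q < 1"
  shows "wall_up A q (Suc n) * wall_coeff A q (Suc (Suc n)) k =
    (wall_up A q (Suc n) + wall_down A q (Suc n)) * wall_coeff A q (Suc n) k
     - (case k of 0 \<Rightarrow> 0 | Suc j \<Rightarrow> wall_coeff A q (Suc n) j)
     - wall_down A q (Suc n) * wall_coeff A q n k"
proof (cases k)
  case 0
  then show ?thesis by (simp add: wall_coeff_def algebra_simps)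
next
  case (Suc j)
  define y where "y = 1 / q ^ Suc n"
  define u where "u = q ^ j"
  define Q where "Q = qpoch y q j"
  define a where "a = qpoch A q j"
  define b where "b = qpoch q q j"
  have nz: "y \<noteq> 0" "q \<noteq> 0" "a \<noteq> 0" "b \<noteq> 0" "1 - A * u \<noteq> 0" "1 - u * q \<noteq> 0"
    using assms qpoch_pos[of A q j] qpoch_pos[of q q j] qpoch_factor_pos(1)[of A q j] qpoch_factor_pos(1)[of q q j]
    by (auto simp: y_def a_def b_def u_def mult.commute)
  have up: "wall_up A q (Suc n) = 1 / y * (1 - A / y)"
    by (simp add: wall_up_def y_def)
  have dn: "wall_down A q (Suc n) = - (A / (q * y\<^sup>2)) * (1 - y)"
    using assms by (simp add: wall_down_def y_def field_simps power2_eq_square)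
  have "1 / q ^ Suc (Suc n) = y / q" by (simp add: y_def)
  then have c2: "wall_coeff A q (Suc (Suc n)) k = (1 - y / q) * (Q * (u * q) / (a * (1 - A * u) * (b * (1 - u * q))))"
    using nz qpoch_Suc_shift[of "y / q" q j]
    by (simp add: wall_coeff_def Suc qpoch_Suc[of A] qpoch_Suc[of q] a_def b_def u_def Q_def mult_ac)
  have c1: "wall_coeff A q (Suc n) k = (1 - y * u) * (Q * (u * q) / (a * (1 - A * u) * (b * (1 - u * q))))"
    by (simp add: wall_coeff_def Suc qpoch_Suc a_def b_def u_def Q_def y_def mult_ac)
  have y: "1 / q ^ n = y * q" using nz by (simp add: y_def)
  have "(1 - y) * qpoch (y * q) q (Suc j) = Q * (1 - y * u) * (1 - y * u * q)"
    unfolding qpoch_Suc_shift[symmetric] by (simp add: qpoch_Suc Q_def u_def mult_ac)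
  then have c0: "(1 - y) * wall_coeff A q n k =
      (1 - y * u) * (1 - y * u * q) * (Q * (u * q) / (a * (1 - A * u) * (b * (1 - u * q))))"
    unfolding wall_coeff_def y Suc by (simp add: qpoch_Suc[of A] qpoch_Suc[of q] a_def b_def u_def mult_ac)
  have cj: "wall_coeff A q (Suc n) j = (1 - A * u) * (1 - u * q) * (Q * u / (a * (1 - A * u) * (b * (1 - u * q))))"
    using nz by (simp add: wall_coeff_def a_def b_def u_def Q_def y_def)
  define R where "R = Q * u / (a * (1 - A * u) * (b * (1 - u * q)))"
  have R: "Q * (u * q) / (a * (1 - A * u) * (b * (1 - u * q))) = q * R" by (simp add: R_def)
  have "wall_up A q (Suc n) * wall_coeff A q (Suc (Suc n)) k
     - (wall_up A q (Suc n) + wall_down A q (Suc n)) * wall_coeff A q (Suc n) k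
     + wall_down A q (Suc n) * wall_coeff A q n k
     = q * (1 / y * (1 - A / y) * (1 - y / q) - (1 / y * (1 - A / y) - A / (q * y\<^sup>2) * (1 - y)) * (1 - y * u)
     - A / (q * y\<^sup>2) * (1 - y * u) * (1 - y * u * q)) * R"
  proof -
    have "wall_down A q (Suc n) * wall_coeff A q n k = - (A / (q * y\<^sup>2)) * ((1 - y) * wall_coeff A q n k)"
      unfolding dn by (simp only: mult.assoc)
    then show ?thesis unfolding c0 c1 c2 R unfolding up dn by (simp only: algebra_simps)
  qed
  also have "\<dots> = - wall_coeff A q (Suc n) j"
    unfolding wall_coeff_identity[OF nz(1,2)] cj R_def[symmetric] by (simp add: algebra_simps)
  finally show ?thesis unfolding Suc by simp
qed

lemma wall_poly_recurrence:
  assumes "0 < A" "A < 1" "0 < q" "q < 1"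
  shows "smult (wall_up A q (Suc n)) (wall_poly A q (Suc (Suc n))) =
    [:wall_up A q (Suc n) + wall_down A q (Suc n), - 1:] * wall_poly A q (Suc n)
     - smult (wall_down A q (Suc n)) (wall_poly A q n)"
proof (rule poly_eqI)
  fix k
  have q: "q \<noteq> 0" using assms by simp
  show "coeff (smult (wall_up A q (Suc n)) (wall_poly A q (Suc (Suc n)))) k =
    coeff ([:wall_up A q (Suc n) + wall_down A q (Suc n), - 1:] * wall_poly A q (Suc n)
     - smult (wall_down A q (Suc n)) (wall_poly A q n)) k"
    using wall_coeff_recurrence[OF assms, of n k]
    by (cases k) (simp_all add: coeff_wall_poly[OF q])
qed

lemma wall_poly_0: "wall_poly A q 0 = 1"
  by (simp add: wall_poly_def wall_coeff_def)

lemma wall_poly_1: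
  assumes "0 < q" "q < 1"
  shows "wall_poly A q (Suc 0) = [:1, - (1 / (1 - A)):]"
proof (rule poly_eqI)
  fix k
  have "(1 - 1 / q) * q / ((1 - A) * (1 - q)) = - (1 / (1 - A))"
  proof -
    have "(1 - 1 / q) * q = - (1 - q)" using assms by (simp add: field_simps)
    moreover have "- r / (a * r) = - (1 / a)" if "r \<noteq> 0" for a r :: real
      using that by simp
    ultimately show ?thesis using assms by (metis diff_gt_0_iff_gt less_irrefl)
  qed
  then have "wall_coeff A q (Suc 0) 1 = - (1 / (1 - A))"
    by (simp add: wall_coeff_def qpoch_Suc)
  moreover have "wall_coeff A q (Suc 0) (Suc (Suc j)) = 0" for j
    using assms qpoch_eq_0[of q 1 "Suc (Suc j)"] by (simp add: wall_coeff_def)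
  moreover have "wall_coeff A q (Suc 0) 0 = 1" by (simp add: wall_coeff_def)
  ultimately show "coeff (wall_poly A q (Suc 0)) k = coeff [:1, - (1 / (1 - A)):] k"
    using assms by (simp add: coeff_wall_poly coeff_pCons numeral_2_eq_2 split: nat.split)
qed

lemma wall_up_pos:
  assumes "0 < A" "A < 1" "0 < q" "q < 1"
  shows "0 < wall_up A q n"
  using assms qpoch_factor_pos(1)[OF assms] by (simp add: wall_up_def)

lemma wall_down_pos:
  assumes "0 < A" "0 < q" "q < 1"
  shows "0 < wall_down A q (Suc n)"
  using assms power_less_one_iff[of q "Suc n"] unfolding wall_down_def by (intro mult_pos_pos) auto

text \<open>
  The recurrence \<open>U P\<^sub>n\<^sub>+\<^sub>1 = (U + D - z) P\<^sub>n - D P\<^sub>n\<^sub>-\<^sub>1\<close> with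
  \<open>U, D > 0\<close> shows that \<open>P\<^sub>n\<^sub>+\<^sub>1 / P\<^sub>n\<close> maps the upper half-plane to the lower one, and
  conversely. The product \<open>P\<^sub>n\<^sub>+\<^sub>1 cnj P\<^sub>n\<close> is this quotient multiplied by \<open>|P\<^sub>n|\<^sup>2\<close>; in this form the strict
  inequality contains the fact that \<open>P\<^sub>n\<close> has no zero off the real axis.
\<close>
lemma wall_poly_nonreal:
  assumes "0 < A" "A < 1" "0 < q" "q < 1" "Im z \<noteq> 0"
  shows "Im (ceval (wall_poly A q (Suc n)) z * cnj (ceval (wall_poly A q n) z)) / Im z < 0"
proof (induction n)
  case 0
  then show ?case using assms by (simp add: wall_poly_0 wall_poly_1)
next
  case (Suc n)
  define P where "P m = ceval (wall_poly A q m) z" for m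
  define U where "U = wall_up A q (Suc n)"
  define D where "D = wall_down A q (Suc n)"
  have pos: "0 < U" "0 < D" using assms wall_up_pos wall_down_pos by (auto simp: U_def D_def)
  have "of_real U * P (Suc (Suc n)) = ceval (smult U (wall_poly A q (Suc (Suc n)))) z"
    by (simp add: P_def)
  also have "\<dots> = (of_real (U + D) - z) * P (Suc n) - of_real D * P n"
    unfolding U_def D_def wall_poly_recurrence[OF assms(1-4)] diff_conv_add_uminus[of "_ * _"] P_def
    by (simp only: ceval_add ceval_mult smult_minus_left[symmetric] ceval_smult) simp
  finally have rec: "of_real U * P (Suc (Suc n)) = (of_real (U + D) - z) * P (Suc n) - of_real D * P n" .
  define w where "w m = P (Suc m) * cnj (P m)" for m
  define N where "N = (norm (P (Suc n)))\<^sup>2"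
  have "of_real U * w (Suc n) =
      (of_real (U + D) - z) * (P (Suc n) * cnj (P (Suc n))) - of_real D * cnj (w n)"
    unfolding w_def mult.assoc[symmetric] rec by (simp add: algebra_simps)
  also have "P (Suc n) * cnj (P (Suc n)) = of_real N"
    unfolding N_def by (rule complex_norm_square[symmetric])
  finally have "Im (of_real U * w (Suc n)) = Im ((of_real (U + D) - z) * of_real N - of_real D * cnj (w n))"
    by (rule arg_cong)
  then have "U * Im (w (Suc n)) = - (Im z * N) + D * Im (w n)" by simp
  then have "U * (Im (w (Suc n)) / Im z) = - N + D * (Im (w n) / Im z)"
    using assms(5) by (simp add: field_simps)
  moreover have "D * (Im (w n) / Im z) < 0"
    using Suc pos unfolding P_def w_def by (intro mult_pos_neg)
  moreover have "0 \<le> N" by (simp add: N_def)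
  ultimately have "U * (Im (w (Suc n)) / Im z) < 0" by linarith
  then have "Im (w (Suc n)) / Im z < 0" using pos by (metis mult_less_0_iff not_less_iff_gr_or_eq)
  then show ?case unfolding w_def P_def .
qed

text \<open>
  On the negative half-line the recurrence makes the increments \<open>P\<^sub>n\<^sub>+\<^sub>1 - P\<^sub>n\<close> nonnegative, so the values
  are at least \<open>P\<^sub>0 = 1\<close>.
\<close>
lemma wall_poly_nonpos:
  assumes "0 < A" "A < 1" "0 < q" "q < 1" "x \<le> 0"
  shows "0 < poly (wall_poly A q n) x \<and> poly (wall_poly A q n) x \<le> poly (wall_poly A q (Suc n)) x"
proof (induction n)
  case 0
  then show ?case using assms by (simp add: wall_poly_0 wall_poly_1 divide_nonpos_pos)
next
  case (Suc n)
  define P where "P m = poly (wall_poly A q m) x" for m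
  define U where "U = wall_up A q (Suc n)"
  define D where "D = wall_down A q (Suc n)"
  have pos: "0 < U" "0 < D" using assms wall_up_pos wall_down_pos by (auto simp: U_def D_def)
  have "U * P (Suc (Suc n)) = poly (smult U (wall_poly A q (Suc (Suc n)))) x"
    by (simp add: P_def)
  also have "\<dots> = (U + D - x) * P (Suc n) - D * P n"
    unfolding U_def D_def wall_poly_recurrence[OF assms(1-4)] P_def poly_diff poly_mult poly_smult by simp
  finally have "U * (P (Suc (Suc n)) - P (Suc n)) = - x * P (Suc n) + D * (P (Suc n) - P n)"
    by (simp add: algebra_simps)
  moreover have "0 \<le> - x * P (Suc n)" "0 \<le> D * (P (Suc n) - P n)"
    using Suc assms(5) pos unfolding P_def by (auto intro!: mult_nonneg_nonneg simp: mult_nonpos_nonneg)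
  ultimately have "0 \<le> U * (P (Suc (Suc n)) - P (Suc n))" by simp
  then have "P (Suc n) \<le> P (Suc (Suc n))" using pos by (simp add: zero_le_mult_iff)
  then show ?case using Suc unfolding P_def by simp
qed

lemma pos_factored_wall_poly:
  assumes "0 < A" "A < 1" "0 < q" "q < 1"
  shows "pos_factored (wall_poly A q n)"
proof (rule pos_factoredI)
  show "poly (wall_poly A q n) 0 = 1"
    using assms by (simp add: poly_0_coeff_0 coeff_wall_poly wall_coeff_def)
  fix z assume z: "ceval (wall_poly A q n) z = 0"
  have im: "Im z = 0" using wall_poly_nonreal[OF assms, of z n] z by auto
  then have "z = of_real (Re z)" by (simp add: complex_eq_iff)
  then have "poly (wall_poly A q n) (Re z) = 0" using z ceval_of_real by (metis of_real_eq_0_iff)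
  then show "Im z = 0 \<and> 0 < Re z" using im wall_poly_nonpos[OF assms, of "Re z" n] by force
qed

section \<open>The Hahn-Exton series as a limit of polynomials\<close>

definition theta :: "'a :: comm_ring_1 fps \<Rightarrow> 'a fps" where
  "theta F = F + 2 * (fps_X * fps_deriv F)"

lemma theta_nth: "theta F $ n = (2 * of_nat n + 1) * F $ n"
  unfolding theta_def by (cases n) (simp_all add: distrib_right)

lemma theta_funpow_nth: "(theta ^^ m) F $ n = (2 * of_nat n + 1) ^ m * F $ n"
  by (induction m) (simp_all add: theta_nth)

lemma fps_of_poly_theta: "fps_of_poly (theta_poly p) = theta (fps_of_poly p)"
proof (rule fps_ext)
  fix n show "fps_of_poly (theta_poly p) $ n = theta (fps_of_poly p) $ n"
    unfolding theta_nth theta_poly_def by (cases n) (simp_all add: coeff_pderiv algebra_simps)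
qed

lemma fps_of_poly_theta_funpow: "fps_of_poly ((theta_poly ^^ m) p) = (theta ^^ m) (fps_of_poly p)"
  by (induction m) (simp_all add: fps_of_poly_theta)

text \<open>
  The Hahn-Exton function in the variable \<open>w = z\<^sup>2\<close>, without the power and the constant in front, with
  \<open>A = q\<^sup>\<nu>\<^sup>+\<^sup>1\<close>.
\<close>
definition hahn_exton_fps :: "real \<Rightarrow> real \<Rightarrow> real fps" where
  "hahn_exton_fps A q = Abs_fps (\<lambda>n. (- 1) ^ n * q ^ (n * (n + 1) div 2) / (qpoch q q n * qpoch A q n))"

text \<open>
  The factor of index \<open>j\<close> of \<open>qpoch (1 / q\<^sup>N) q k * (q\<^sup>N)\<^sup>k\<close> is \<open>q\<^sup>N - q\<^sup>j\<close>, which tends to \<open>- q\<^sup>j\<close>.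
\<close>
lemma qpoch_rescaled_limit:
  assumes "0 < q" "q < 1"
  shows "(\<lambda>N. qpoch (1 / q ^ N) q k * (q ^ N) ^ k * q ^ k) \<longlonglongrightarrow> (- 1) ^ k * q ^ (k * (k + 1) div 2)"
proof (induction k)
  case 0
  then show ?case by simp
next
  case (Suc k)
  have e: "Suc k * (Suc k + 1) div 2 = k * (k + 1) div 2 + Suc k" by simp
  have eq: "qpoch (1 / q ^ N) q (Suc k) * (q ^ N) ^ Suc k * q ^ Suc k =
      qpoch (1 / q ^ N) q k * (q ^ N) ^ k * q ^ k * ((q ^ N - q ^ k) * q)" for N
    using assms by (simp add: qpoch_Suc field_simps)
  have lim: "(\<lambda>N. qpoch (1 / q ^ N) q k * (q ^ N) ^ k * q ^ k * ((q ^ N - q ^ k) * q))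
      \<longlonglongrightarrow> (- 1) ^ k * q ^ (k * (k + 1) div 2) * ((0 - q ^ k) * q)"
    by (intro tendsto_intros Suc LIMSEQ_power_zero) (use assms in auto)
  have val: "(- 1) ^ k * q ^ (k * (k + 1) div 2) * ((0 - q ^ k) * q) =
      (- 1) ^ Suc k * q ^ (Suc k * (Suc k + 1) div 2)"
    unfolding e power_add by simp
  show ?case unfolding eq val[symmetric] by (rule lim)
qed

text \<open>
  The rescaled Wall polynomials \<open>wall_poly A q N (q\<^sup>N w)\<close> converge coefficientwise to the Hahn-Exton series,
  and so do their images under powers of \<open>theta\<close>. All these polynomials have positive zeros only, and
  the inequalities for their power sums pass to the limit.
\<close>
lemma power_sum_bounds_hahn_exton:
  assumes "0 < A" "A < 1" "0 < q" "q < 1"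
  shows "power_sum_bounds (fps_nth (neg_log_deriv ((theta ^^ m) (hahn_exton_fps A q))))"
proof -
  define p where "p N = (theta_poly ^^ m) (pcompose (wall_poly A q N) [:0, q ^ N:])" for N
  define c :: "nat \<Rightarrow> real" where "c k = (2 * real k + 1) ^ m" for k
  have coeff: "fps_of_poly (p N) $ k = c k * ((q ^ N) ^ k * wall_coeff A q N k)" for N k
    unfolding p_def fps_of_poly_theta_funpow theta_funpow_nth c_def
    using assms by (simp add: coeff_pcompose_linear coeff_wall_poly)
  have pos: "pos_factored (p N)" for N
  proof -
    have "pos_factored ((theta_poly ^^ i) (pcompose (wall_poly A q N) [:0, q ^ N:]))" for i
      by (induction i) (use assms in \<open>simp_all add: pos_factored_wall_poly pos_factored_rescale pos_factored_theta\<close>)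
    then show ?thesis by (simp add: p_def)
  qed
  have lim: "(\<lambda>N. fps_of_poly (p N) $ k) \<longlonglongrightarrow> (theta ^^ m) (hahn_exton_fps A q) $ k" for k
  proof -
    have "fps_of_poly (p N) $ k =
        c k * (qpoch (1 / q ^ N) q k * (q ^ N) ^ k * q ^ k / (qpoch A q k * qpoch q q k))" for N
      unfolding coeff wall_coeff_def by simp
    moreover have "(\<lambda>N. c k * (qpoch (1 / q ^ N) q k * (q ^ N) ^ k * q ^ k / (qpoch A q k * qpoch q q k)))
        \<longlonglongrightarrow> c k * ((- 1) ^ k * q ^ (k * (k + 1) div 2) / (qpoch A q k * qpoch q q k))"
      using qpoch_pos[OF assms, of k] qpoch_pos[of q q k] assms
      by (intro tendsto_intros qpoch_rescaled_limit) auto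
    ultimately show ?thesis
      by (simp add: theta_funpow_nth hahn_exton_fps_def c_def mult.commute)
  qed
  show ?thesis
  proof (rule power_sum_bounds_tendsto)
    show "power_sum_bounds (fps_nth (neg_log_deriv (fps_of_poly (p N))))" for N
      by (rule power_sum_bounds_pos_factored[OF pos])
    show "(\<lambda>N. neg_log_deriv (fps_of_poly (p N)) $ n) \<longlonglongrightarrow>
        neg_log_deriv ((theta ^^ m) (hahn_exton_fps A q)) $ n" for n
    proof (rule neg_log_deriv_tendsto)
      show "fps_of_poly (p N) $ 0 = 1" for N
        unfolding coeff by (simp add: c_def wall_coeff_def)
      show "(theta ^^ m) (hahn_exton_fps A q) $ 0 = 1"
        by (simp add: theta_funpow_nth hahn_exton_fps_def)
    qed (rule lim)
  qed
qed

section \<open>Entire functions with nonnegative power sums\<close>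

definition cfps :: "real fps \<Rightarrow> complex fps" where
  "cfps F = Abs_fps (\<lambda>n. of_real (F $ n))"

lemma cfps_nth [simp]: "cfps F $ n = of_real (F $ n)"
  by (simp add: cfps_def)

lemma cfps_mult: "cfps (F * G) = cfps F * cfps G"
  by (rule fps_ext) (simp add: fps_mult_nth)

lemma cfps_uminus: "cfps (- F) = - cfps F"
  by (rule fps_ext) simp

lemma cfps_deriv: "cfps (fps_deriv F) = fps_deriv (cfps F)"
  by (rule fps_ext) simp

lemma cfps_theta: "cfps (theta F) = theta (cfps F)"
  by (rule fps_ext) (simp add: theta_nth)

lemma fps_conv_radius_cfps [simp]: "fps_conv_radius (cfps F) = fps_conv_radius F"
  by (simp add: fps_conv_radius_def conv_radius_def)

lemma eval_cfps_of_real: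
  assumes "ereal \<bar>x\<bar> < fps_conv_radius F"
  shows "eval_fps (cfps F) (of_real x) = of_real (eval_fps F x)"
proof -
  have "summable (\<lambda>n. F $ n * x ^ n)" using assms by (intro summable_fps) simp
  from suminf_of_real[OF this, where 'a = complex] show ?thesis by (simp add: eval_fps_def)
qed

lemma fps_conv_radius_integral0:
  fixes F :: "complex fps"
  shows "fps_conv_radius (fps_integral0 F) \<ge> fps_conv_radius F"
proof -
  have "fps_conv_radius (fps_integral0 F) = fps_conv_radius (fps_shift 1 (fps_integral0 F))"
    by simp
  moreover have "fps_conv_radius F \<le> fps_conv_radius (fps_shift 1 (fps_integral0 F))"
    unfolding fps_conv_radius_def
  proof (rule conv_radius_geI_ex')
    fix r :: real assume r: "0 < r" "ereal r < conv_radius (fps_nth F)"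
    have le: "norm (fps_shift 1 (fps_integral0 F) $ n * of_real r ^ n) \<le> norm (F $ n * of_real r ^ n)" for n
    proof -
      have "norm (F $ n) / real (Suc n) \<le> norm (F $ n)"
        by (simp add: divide_le_eq mult_le_cancel_left1)
      then have "norm (fps_shift 1 (fps_integral0 F) $ n) \<le> norm (F $ n)"
        by (simp add: norm_mult norm_inverse divide_inverse mult.commute del: of_nat_Suc)
      then show ?thesis unfolding norm_mult by (intro mult_right_mono) auto
    qed
    have "summable (\<lambda>n. norm (F $ n * of_real r ^ n))"
      using r by (intro abs_summable_in_conv_radius) simp
    then show "summable (\<lambda>n. fps_shift 1 (fps_integral0 F) $ n * of_real r ^ n)"
      by (rule summable_comparison_test'[of _ 0]) (rule le)
  qed
  ultimately show ?thesis by simp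
qed

lemma fps_conv_radius_theta:
  fixes F :: "'a :: {banach, real_normed_field} fps"
  shows "fps_conv_radius (theta F) \<ge> fps_conv_radius F"
proof -
  have "fps_conv_radius F \<le> fps_conv_radius (fps_X * fps_deriv F)"
    using fps_conv_radius_mult[of fps_X "fps_deriv F"] fps_conv_radius_deriv[of F] by simp
  then have "fps_conv_radius F \<le> fps_conv_radius (2 * (fps_X * fps_deriv F))"
    using fps_conv_radius_mult[of 2 "fps_X * fps_deriv F"] by simp
  then show ?thesis
    unfolding theta_def using fps_conv_radius_add[of F "2 * (fps_X * fps_deriv F)"] by simp
qed

lemma eval_fps_theta:
  fixes F :: "'a :: {banach, real_normed_field} fps"
  assumes "fps_conv_radius F = \<infinity>"
  shows "eval_fps (theta F) w = eval_fps F w + 2 * w * eval_fps (fps_deriv F) w"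
proof -
  have 1: "fps_conv_radius (fps_deriv F) = \<infinity>" using assms fps_conv_radius_deriv[of F] by simp
  have 2: "fps_conv_radius (fps_X * fps_deriv F) = \<infinity>"
    using fps_conv_radius_mult[of fps_X "fps_deriv F"] 1 by simp
  have 3: "fps_conv_radius (2 * (fps_X * fps_deriv F)) = \<infinity>"
    using fps_conv_radius_mult[of 2 "fps_X * fps_deriv F"] 2 by simp
  show ?thesis unfolding theta_def
    using assms 1 2 3 by (simp add: eval_fps_add eval_fps_mult)
qed

lemma eval_fps_nonneg_norm_le:
  assumes "\<And>n. 0 \<le> F $ n" "ereal (norm w) < fps_conv_radius F"
  shows "norm (eval_fps (cfps F) w) \<le> eval_fps F (norm w)"
proof -
  have s: "summable (\<lambda>n. norm (cfps F $ n * w ^ n))"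
    using assms(2) by (intro norm_summable_fps) simp
  have "norm (eval_fps (cfps F) w) \<le> (\<Sum>n. norm (cfps F $ n * w ^ n))"
    unfolding eval_fps_def by (rule summable_norm[OF s])
  also have "\<dots> = eval_fps F (norm w)"
    unfolding eval_fps_def using assms(1) by (simp add: norm_mult norm_power)
  finally show ?thesis .
qed

context
  fixes G S :: "real fps"
  assumes entire: "fps_conv_radius G = \<infinity>"
    and G0: "G $ 0 = 1"
    and log_deriv: "S * G = - fps_deriv G"
    and S_nonneg: "\<And>n. 0 \<le> S $ n"
begin

lemma log_deriv_eq_divide: "cfps S = - fps_deriv (cfps G) / cfps G"
proof -
  have "cfps G \<noteq> 0" using G0 by (metis cfps_nth fps_zero_nth of_real_1 zero_neq_one)
  moreover have "cfps S * cfps G = - fps_deriv (cfps G)"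
    using arg_cong[OF log_deriv, of cfps] by (simp only: cfps_mult cfps_uminus cfps_deriv)
  ultimately show ?thesis by (metis nonzero_mult_div_cancel_right)
qed

lemma log_deriv_conv_radius_pos: "0 < fps_conv_radius S"
proof -
  have "0 < fps_conv_radius (inverse (cfps G))"
    using G0 entire by (intro fps_conv_radius_inverse_pos) auto
  also have "\<dots> = min (fps_conv_radius (- fps_deriv (cfps G))) (fps_conv_radius (inverse (cfps G)))"
    using fps_conv_radius_deriv[of "cfps G"] entire by (simp add: min_def)
  also have "\<dots> \<le> fps_conv_radius (- fps_deriv (cfps G) * inverse (cfps G))"
    by (rule fps_conv_radius_mult)
  also have "- fps_deriv (cfps G) * inverse (cfps G) = cfps S"
    unfolding log_deriv_eq_divide using G0 by (simp add: fps_divide_unit)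
  finally show ?thesis by simp
qed

lemma eval_log_deriv:
  assumes "ereal (norm w) < fps_conv_radius S"
  shows "eval_fps (fps_deriv (cfps G)) w = - (eval_fps (cfps S) w * eval_fps (cfps G) w)"
proof -
  have "- fps_deriv (cfps G) = cfps S * cfps G"
    using arg_cong[OF log_deriv, of cfps] by (simp only: cfps_mult cfps_uminus cfps_deriv)
  then have "fps_deriv (cfps G) = - (cfps S * cfps G)" by (metis minus_minus)
  moreover have "fps_conv_radius (cfps S * cfps G) \<ge> fps_conv_radius S"
    using fps_conv_radius_mult[of "cfps S" "cfps G"] entire by simp
  ultimately show ?thesis using assms entire
    by (simp add: eval_fps_minus eval_fps_mult less_le_trans[OF assms])
qed

text \<open>
  Both sides agree at \<open>0\<close>, and the left-hand side has derivative \<open>0\<close> because \<open>G' = - S G\<close>.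
\<close>
lemma exp_log_integral:
  assumes "ereal (norm w) < fps_conv_radius S"
  shows "eval_fps (cfps G) w * exp (eval_fps (fps_integral0 (cfps S)) w) = 1"
proof -
  define H where "H = fps_integral0 (cfps S)"
  have H: "fps_conv_radius H \<ge> fps_conv_radius S"
    using fps_conv_radius_integral0[of "cfps S"] by (simp add: H_def)
  have H': "fps_deriv H = cfps S" by (simp add: H_def fps_deriv_fps_integral)
  obtain K where K: "norm w < K" "ereal K < fps_conv_radius S"
    using ereal_dense2[OF assms] by auto
  define f where "f = (\<lambda>z. eval_fps (cfps G) z * exp (eval_fps H z))"
  have "(f has_field_derivative 0) (at z within ball 0 K)" if "z \<in> ball 0 K" for z
  proof -
    have z: "ereal (norm z) < fps_conv_radius S"
      using that K(2) less_trans[of "ereal (norm z)" "ereal K"] by simp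
    then have zH: "ereal (norm z) < fps_conv_radius H" using H by (rule less_le_trans)
    have "(f has_field_derivative
        eval_fps (fps_deriv (cfps G)) z * exp (eval_fps H z)
        + exp (eval_fps H z) * eval_fps (fps_deriv H) z * eval_fps (cfps G) z) (at z within ball 0 K)"
      unfolding f_def using zH entire
      by (intro DERIV_mult DERIV_chain2[OF DERIV_exp] has_field_derivative_eval_fps) auto
    also have "eval_fps (fps_deriv (cfps G)) z * exp (eval_fps H z)
        + exp (eval_fps H z) * eval_fps (fps_deriv H) z * eval_fps (cfps G) z = 0"
      unfolding eval_log_deriv[OF z] H' by simp
    finally show ?thesis .
  qed
  then obtain c where c: "\<And>z. z \<in> ball 0 K \<Longrightarrow> f z = c"
    using has_field_derivative_zero_constant[of "ball 0 K" f] by auto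
  have "0 < K" using K(1) norm_ge_zero[of w] by linarith
  then have "f 0 = c" "f w = c" using c K(1) by auto
  moreover have "f 0 = 1" by (simp add: f_def eval_fps_at_0 G0 H_def)
  ultimately show ?thesis by (simp add: f_def H_def)
qed

lemma nonzero_in_disc:
  assumes "ereal (norm w) < fps_conv_radius S"
  shows "eval_fps (cfps G) w \<noteq> 0"
  using exp_log_integral[OF assms] by auto

text \<open>
  Here \<open>|G(w)| = exp (- Re H(w))\<close> where \<open>H\<close> is the integral of \<open>S\<close>. As \<open>H\<close> has nonnegative
  coefficients, its real part on a circle is largest at the positive real point.
\<close>
lemma norm_ge_on_radius:
  assumes "ereal (norm w) < fps_conv_radius S"
  shows "norm (eval_fps (cfps G) (of_real (norm w))) \<le> norm (eval_fps (cfps G) w)"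
proof -
  define H where "H = fps_integral0 S"
  have cH: "cfps H = fps_integral0 (cfps S)"
  proof (rule fps_ext)
    fix n show "cfps H $ n = fps_integral0 (cfps S) $ n" by (cases n) (simp_all add: H_def)
  qed
  have r: "ereal (norm w) < fps_conv_radius H"
    using assms fps_conv_radius_integral0[of "cfps S"] unfolding cH[symmetric] by simp
  have nonneg: "0 \<le> H $ n" for n
    using S_nonneg by (cases n) (simp_all add: H_def del: of_nat_Suc)
  have eq: "norm (eval_fps (cfps G) z) = exp (- Re (eval_fps (cfps H) z))"
    if "norm z = norm w" for z
  proof -
    have "eval_fps (cfps G) z * exp (eval_fps (cfps H) z) = 1"
      unfolding cH using assms that by (intro exp_log_integral) simp
    then have "norm (eval_fps (cfps G) z) * exp (Re (eval_fps (cfps H) z)) = 1"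
      by (metis norm_exp_eq_Re norm_mult norm_one)
    then show ?thesis by (simp add: exp_minus field_simps)
  qed
  have "Re (eval_fps (cfps H) w) \<le> norm (eval_fps (cfps H) w)" by (rule complex_Re_le_cmod)
  also have "\<dots> \<le> eval_fps H (norm w)" by (rule eval_fps_nonneg_norm_le[OF nonneg r])
  also have "\<dots> = Re (eval_fps (cfps H) (of_real (norm w)))"
    using r by (subst eval_cfps_of_real) auto
  finally show ?thesis by (simp add: eq)
qed

text \<open>
  A form of Pringsheim's theorem. If \<open>G(r) \<noteq> 0\<close>, then \<open>G\<close> has no zero on the circle of radius \<open>r\<close>
  because \<open>|G|\<close> is smallest at the positive point. By compactness \<open>G\<close> has no zero in some larger
  disc, so that \<open>S = - G' / G\<close> converges there, although \<open>r\<close> is its radius of convergence.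
\<close>
lemma zero_at_radius:
  assumes "fps_conv_radius S = ereal r"
  shows "eval_fps (cfps G) (of_real r) = 0"
proof (rule ccontr)
  assume nz: "eval_fps (cfps G) (of_real r) \<noteq> 0"
  have r: "0 < r" using log_deriv_conv_radius_pos assms by simp
  have cont: "continuous_on UNIV (eval_fps (cfps G))"
    using continuous_on_eval_fps[of "cfps G"] entire by simp
  have boundary: "eval_fps (cfps G) w \<noteq> 0" if w: "norm w = r" for w
  proof -
    have lim: "((\<lambda>t. norm (eval_fps (cfps G) (of_real t * u))) \<longlongrightarrow> norm (eval_fps (cfps G) (of_real 1 * u))) (at_left 1)" for u
      by (intro tendsto_norm continuous_on_tendsto_compose[OF cont] tendsto_intros) auto
    have "eventually (\<lambda>t. t \<in> {0<..<1}) (at_left (1::real))"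
      by (rule eventually_at_left_real) simp
    then have "eventually (\<lambda>t. norm (eval_fps (cfps G) (of_real t * of_real r))
        \<le> norm (eval_fps (cfps G) (of_real t * w))) (at_left 1)"
    proof eventually_elim
      case (elim t)
      then have "norm (of_real t * w) = t * r" using w by (simp add: norm_mult)
      moreover have "t * r < r" using elim r by simp
      ultimately show ?case using norm_ge_on_radius[of "of_real t * w"] assms by simp
    qed
    from tendsto_le[OF _ lim lim this]
    have "norm (eval_fps (cfps G) (of_real r)) \<le> norm (eval_fps (cfps G) w)" by simp
    then show ?thesis using nz by auto
  qed
  have "cball 0 r \<subseteq> {w. eval_fps (cfps G) w \<noteq> 0}"
    using boundary nonzero_in_disc assms by (force simp: le_less)
  moreover have "open {w. eval_fps (cfps G) w \<noteq> 0}"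
    by (intro open_Collect_neq cont continuous_on_const)
  ultimately obtain e where e: "0 < e" "(\<Union>x\<in>cball 0 r. ball x e) \<subseteq> {w. eval_fps (cfps G) w \<noteq> 0}"
    using compact_subset_open_imp_ball_epsilon_subset[OF compact_cball] by metis
  have nz': "eval_fps (cfps G) z \<noteq> 0" if "z \<in> eball 0 (ereal (r + e))" for z
  proof (cases "norm z \<le> r")
    case True
    then show ?thesis using e by (force intro: centre_in_ball[THEN iffD2])
  next
    case False
    \<comment> \<open>The radial projection to the circle is the nearest point of the disc.\<close>
    define x where "x = of_real (r / norm z) * z"
    have nz0: "norm z > 0" using False r by linarith
    have nx: "norm x = r" using nz0 r by (simp add: x_def norm_mult norm_divide)
    have "z - x = of_real (1 - r / norm z) * z" by (simp add: x_def algebra_simps)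
    then have "norm (z - x) = \<bar>1 - r / norm z\<bar> * norm z" by (simp only: norm_mult norm_of_real)
    moreover have "1 - r / norm z \<ge> 0" using False nz0 by simp
    ultimately have "norm (z - x) = (1 - r / norm z) * norm z" by simp
    also have "\<dots> = norm z - r" using nz0 by (simp add: left_diff_distrib)
    finally have "norm (z - x) = norm z - r" .
    then have "z \<in> ball x e" using that by (simp add: dist_norm norm_minus_commute)
    then show ?thesis using e(2) nx by force
  qed
  have "ereal (r + e) \<le> Min {ereal (r + e), fps_conv_radius (- fps_deriv (cfps G)), fps_conv_radius (cfps G)}"
    using fps_conv_radius_deriv[of "cfps G"] entire by simp
  also have "\<dots> \<le> fps_conv_radius (- fps_deriv (cfps G) / cfps G)"
    using fps_conv_radius_deriv[of "cfps G"] entire r e nz'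
    by (intro fps_conv_radius_divide') auto
  finally show False using assms e unfolding log_deriv_eq_divide[symmetric] by simp
qed

text \<open>
  Since \<open>theta G = G (1 - 2 w S)\<close> and \<open>S\<close> has nonnegative coefficients, the real part of
  \<open>theta G / G\<close> at \<open>w\<close> is at least the value at \<open>|w|\<close>. This value is positive up to the first positive
  zero of \<open>theta G\<close>, and \<open>G\<close> has no earlier zero: at its first zero \<open>p\<close> one has
  \<open>(theta G)(p) = 2 p G'(p) \<le> 0\<close>.
\<close>
lemma theta_quotient_pos:
  assumes "\<And>t. 0 \<le> t \<Longrightarrow> t < \<delta> \<Longrightarrow> eval_fps (theta G) t \<noteq> 0" "norm w < \<delta>"
  shows "eval_fps (cfps G) w \<noteq> 0"
    and "0 < Re (eval_fps (cfps (theta G)) w / eval_fps (cfps G) w)"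
proof -
  have G_real: "eval_fps (cfps G) (of_real t) = of_real (eval_fps G t)" for t
    using entire by (simp add: eval_cfps_of_real)
  have entire': "fps_conv_radius (fps_deriv G) = \<infinity>" "fps_conv_radius (theta G) = \<infinity>"
    using entire fps_conv_radius_deriv[of G] fps_conv_radius_theta[of G] by simp_all
  have contG: "continuous_on T (eval_fps G)" "continuous_on T (eval_fps (theta G))" for T
    using entire entire' by (auto intro!: continuous_on_eval_fps' continuous_on_id)
  have theta_pos: "0 < eval_fps (theta G) t" if "0 \<le> t" "t < \<delta>" for t
  proof (rule ccontr)
    note t = that
    assume "\<not> 0 < eval_fps (theta G) t"
    then obtain x where "0 \<le> x" "x \<le> t" "eval_fps (theta G) x = 0"
      using IVT2'[of "eval_fps (theta G)" t 0 0] t contG by (auto simp: eval_fps_at_0 theta_nth G0)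
    then show False using assms(1)[of x] that by simp
  qed
  have G_pos: "0 < eval_fps G t" if "0 \<le> t" "ereal t < fps_conv_radius S" for t
  proof (rule ccontr)
    note t = that
    assume "\<not> 0 < eval_fps G t"
    then obtain x where x: "0 \<le> x" "x \<le> t" "eval_fps G x = 0"
      using IVT2'[of "eval_fps G" t 0 0] t contG by (auto simp: eval_fps_at_0 G0)
    then have "ereal (norm (of_real x :: complex)) < fps_conv_radius S"
      using le_less_trans[of "ereal x" "ereal t"] that by simp
    from nonzero_in_disc[OF this] show False using x G_real by simp
  qed
  have radius: "ereal \<delta> \<le> fps_conv_radius S"
  proof (rule ccontr)
    assume "\<not> ereal \<delta> \<le> fps_conv_radius S"
    then obtain p where p: "fps_conv_radius S = ereal p" "p < \<delta>"
      using log_deriv_conv_radius_pos by (cases "fps_conv_radius S") auto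
    have "0 < p" using p log_deriv_conv_radius_pos by simp
    have zero: "eval_fps G p = 0" using zero_at_radius[OF p(1)] G_real by simp
    have "0 < eval_fps (theta G) p" using theta_pos p \<open>0 < p\<close> by simp
    then have "0 < eval_fps (fps_deriv G) p"
      using zero entire \<open>0 < p\<close> by (simp add: eval_fps_theta zero_less_mult_iff)
    moreover have "(eval_fps G has_real_derivative eval_fps (fps_deriv G) p) (at p)"
      using entire by (intro has_field_derivative_eval_fps) simp
    ultimately obtain d where d: "0 < d" "\<And>h. 0 < h \<Longrightarrow> h < d \<Longrightarrow> eval_fps G (p - h) < 0"
      using DERIV_pos_inc_left[of "eval_fps G" _ p] zero by metis
    define h where "h = min (d / 2) (p / 2)"
    have h: "0 < h" "h < d" "h < p" using d(1) \<open>0 < p\<close> by (auto simp: h_def)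
    have "eval_fps G (p - h) < 0" using d(2) h by simp
    moreover have "0 < eval_fps G (p - h)" using h p by (intro G_pos) auto
    ultimately show False by simp
  qed
  have w: "ereal (norm w) < fps_conv_radius S"
    using assms(2) radius by (metis less_ereal.simps(1) less_le_trans)
  show nz: "eval_fps (cfps G) w \<noteq> 0" using nonzero_in_disc[OF w] .
  have theta_eq: "eval_fps (cfps (theta G)) z = eval_fps (cfps G) z * (1 - 2 * z * eval_fps (cfps S) z)"
    if "ereal (norm z) < fps_conv_radius S" for z
    using eval_log_deriv[OF that] entire by (simp add: cfps_theta eval_fps_theta algebra_simps)
  define t where "t = norm w"
  have t: "0 \<le> t" "t < \<delta>" "ereal t < fps_conv_radius S" using assms(2) w by (simp_all add: t_def)
  have S_real: "eval_fps (cfps S) (of_real t) = of_real (eval_fps S t)"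
    using t by (intro eval_cfps_of_real) simp
  have "of_real (eval_fps (theta G) t) = (of_real (eval_fps G t * (1 - 2 * t * eval_fps S t)) :: complex)"
    using theta_eq[of "of_real t"] t entire' by (simp add: G_real S_real eval_cfps_of_real)
  then have "eval_fps (theta G) t = eval_fps G t * (1 - 2 * t * eval_fps S t)"
    unfolding of_real_eq_iff .
  then have "0 < 1 - 2 * t * eval_fps S t"
    using theta_pos[OF t(1,2)] G_pos[OF t(1,3)] by (simp add: zero_less_mult_iff)
  moreover have "Re (2 * w * eval_fps (cfps S) w) \<le> 2 * t * eval_fps S t"
  proof -
    have "Re (2 * w * eval_fps (cfps S) w) \<le> norm (2 * w * eval_fps (cfps S) w)"
      by (rule complex_Re_le_cmod)
    also have "\<dots> = 2 * t * norm (eval_fps (cfps S) w)" by (simp add: norm_mult t_def)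
    also have "\<dots> \<le> 2 * t * eval_fps S t"
      unfolding t_def using w by (intro mult_left_mono eval_fps_nonneg_norm_le S_nonneg) auto
    finally show ?thesis .
  qed
  ultimately show "0 < Re (eval_fps (cfps (theta G)) w / eval_fps (cfps G) w)"
    unfolding theta_eq[OF w] using nz by simp
qed

end

section \<open>Euler-Rayleigh estimates\<close>

lemma power_sum_ratio_le:
  fixes s :: "nat \<Rightarrow> real"
  assumes "power_sum_bounds s" "0 < s 0" "0 < s 1"
  shows "0 < s n" and "n \<le> m \<Longrightarrow> s (Suc n) / s n \<le> s (Suc m) / s m"
proof -
  have pos: "0 < s n \<and> 0 < s (Suc n)" for n
  proof (induction n)
    case (Suc n)
    then have "0 < (s (Suc n))\<^sup>2" by simp
    also have "\<dots> \<le> s n * s (Suc (Suc n))" using assms(1) by (simp add: power_sum_bounds_def)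
    finally show ?case using Suc by (simp add: zero_less_mult_iff)
  qed (use assms in simp)
  then show "0 < s n" by simp
  have "s (Suc n) / s n \<le> s (Suc (Suc n)) / s (Suc n)" for n
    using pos[of n] assms(1) by (simp add: power_sum_bounds_def field_simps power2_eq_square)
  then show "n \<le> m \<Longrightarrow> s (Suc n) / s n \<le> s (Suc m) / s m"
    by (rule lift_Suc_mono_le)
qed

text \<open>
  The ratios \<open>s (Suc n) / s n\<close> increase, so at the point \<open>s n / s (Suc n)\<close> the terms of the series do not
  decrease from the index \<open>n\<close> on, and the series diverges.
\<close>
lemma conv_radius_power_sums_le:
  fixes s :: "nat \<Rightarrow> real"
  assumes "power_sum_bounds s" "0 < s 0" "0 < s 1"
  shows "conv_radius s \<le> ereal (s n / s (Suc n))"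
proof -
  note pos = power_sum_ratio_le(1)[OF assms] and mono = power_sum_ratio_le(2)[OF assms]
  define x where "x = s n / s (Suc n)"
  have x: "0 < x" using pos by (simp add: x_def)
  have grow: "s n * x ^ n \<le> s (n + k) * x ^ (n + k)" for k
  proof (induction k)
    case (Suc k)
    have "1 \<le> s (Suc (n + k)) / s (n + k) * x"
      using mono[of n "n + k"] pos by (simp add: x_def field_simps)
    then have "s (n + k) \<le> s (Suc (n + k)) * x" using pos[of "n + k"] by (simp add: field_simps)
    then have "s (n + k) * x ^ (n + k) \<le> s (Suc (n + k)) * x * x ^ (n + k)"
      using x by (intro mult_right_mono) auto
    then show ?case using Suc by (simp add: mult_ac)
  qed simp
  have "\<not> summable (\<lambda>k. s k * x ^ k)"
  proof
    assume "summable (\<lambda>k. s k * x ^ k)"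
    then have "(\<lambda>k. s (k + n) * x ^ (k + n)) \<longlonglongrightarrow> 0"
      by (intro LIMSEQ_ignore_initial_segment summable_LIMSEQ_zero)
    then have "s n * x ^ n \<le> 0"
      by (rule tendsto_lowerbound) (use grow in \<open>auto simp: add.commute\<close>)
    moreover have "0 < s n * x ^ n" using pos[of n] x by simp
    ultimately show False by simp
  qed
  then have "conv_radius s \<le> ereal (norm x)" by (rule conv_radius_leI')
  then have "conv_radius s \<le> ereal x" using x by simp
  then show ?thesis by (simp only: x_def)
qed

lemma conv_radius_power_sums_ge:
  fixes s :: "nat \<Rightarrow> real"
  assumes "power_sum_bounds s" "0 < s 2"
  shows "conv_radius s \<ge> ereal (1 / root 3 (s 2))"
proof -
  define k where "k = root 3 (s 2)"
  have k: "0 < k" using assms(2) by (simp add: k_def)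
  have le: "s n \<le> s 0 * k ^ n" and nonneg: "0 \<le> s n" for n
  proof -
    show "s n \<le> s 0 * k ^ n"
    proof (induction n)
      case (Suc n)
      have "s (Suc n) \<le> k * s n" using assms(1) by (simp add: power_sum_bounds_def k_def)
      also have "\<dots> \<le> k * (s 0 * k ^ n)" using k Suc by simp
      finally show ?case by (simp add: mult_ac)
    qed simp
    show "0 \<le> s n" using assms(1) by (simp add: power_sum_bounds_def)
  qed
  have "conv_radius s \<ge> ereal (1 / k)"
  proof (rule conv_radius_geI_ex')
    fix r :: real assume r: "0 < r" "ereal r < ereal (1 / k)"
    then have "k * r < 1" using k by (simp add: field_simps)
    then have sm: "summable (\<lambda>n. s 0 * (k * r) ^ n)"
      using k r by (intro summable_mult summable_geometric) simp
    have "norm (s n * of_real r ^ n) \<le> s 0 * (k * r) ^ n" for n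
      using le[of n] nonneg[of n] r(1) by (simp add: abs_mult power_mult_distrib)
    then show "summable (\<lambda>n. s n * of_real r ^ n)"
      by (intro summable_comparison_test'[OF sm, of 0])
  qed
  then show ?thesis by (simp add: k_def)
qed

lemma tendsto_0_if_Suc_times_tendsto_0:
  fixes f :: "nat \<Rightarrow> real"
  assumes "(\<lambda>n. real (Suc n) * f n) \<longlonglongrightarrow> 0"
  shows "f \<longlonglongrightarrow> 0"
proof -
  have "(\<lambda>n. real (Suc n) * f n * inverse (real (Suc n))) \<longlonglongrightarrow> 0 * 0"
    by (intro tendsto_mult assms LIMSEQ_inverse_real_of_nat)
  moreover have "real (Suc n) * f n * inverse (real (Suc n)) = f n" for n
    by (simp add: field_simps del: of_nat_Suc)
  ultimately show ?thesis by (simp del: of_nat_Suc)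
qed

text \<open>
  This excludes equality in the estimates. If \<open>S\<close> is geometric from index \<open>1\<close> on, then \<open>(1 - c X) S\<close> is a
  linear polynomial \<open>a + b X\<close>, and \<open>- (1 - c X) G' = (a + b X) G\<close> is a three-term recurrence for the
  coefficients of \<open>G\<close>. For coefficients whose successive ratios tend to \<open>0\<close> faster than \<open>1/n\<close>, the
  dominant term of the recurrence forces first \<open>b = 0\<close> and then \<open>c = 0\<close>.
\<close>
lemma power_sums_not_geometric:
  fixes G S :: "real fps"
  assumes "S * G = - fps_deriv G" "\<And>n. G $ n \<noteq> 0"
    and "(\<lambda>n. real (Suc n) * (G $ Suc n / G $ n)) \<longlonglongrightarrow> 0"
    and "\<And>n. 1 \<le> n \<Longrightarrow> S $ Suc n = c * S $ n"
  shows "c = 0"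
proof -
  define r where "r n = G $ Suc n / G $ n" for n
  define a where "a = S $ 0"
  define b where "b = S $ 1 - c * S $ 0"
  have "(1 - fps_const c * fps_X) * S = fps_const a + fps_const b * fps_X"
  proof (rule fps_ext)
    fix n
    show "((1 - fps_const c * fps_X) * S) $ n = (fps_const a + fps_const b * fps_X) $ n"
    proof (cases n)
      case 0
      then show ?thesis by (simp add: a_def)
    next
      case (Suc m)
      have "((1 - fps_const c * fps_X) * S) $ Suc m = S $ Suc m - c * S $ m"
        by (simp add: left_diff_distrib mult.assoc)
      moreover have "S $ Suc m - c * S $ m = (if m = 0 then b else 0)"
        using assms(4)[of m] by (simp add: b_def)
      ultimately show ?thesis using Suc by simp
    qed
  qed
  then have "(1 - fps_const c * fps_X) * (S * G) = (fps_const a + fps_const b * fps_X) * G"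
    by (metis mult.assoc)
  then have coeffs: "((1 - fps_const c * fps_X) * (S * G)) $ Suc n = ((fps_const a + fps_const b * fps_X) * G) $ Suc n" for n
    by (rule arg_cong)
  have rec: "- (real (n + 2) * G $ Suc (Suc n)) + c * (real (Suc n) * G $ Suc n) = a * G $ Suc n + b * G $ n" for n
    using coeffs[of n] unfolding assms(1) by (simp add: left_diff_distrib distrib_right mult.assoc)
  have lim1: "(\<lambda>n. real (Suc n) * r n) \<longlonglongrightarrow> 0" using assms(3) by (simp add: r_def)
  then have lim2: "(\<lambda>n. real (n + 2) * r (Suc n)) \<longlonglongrightarrow> 0"
    using LIMSEQ_Suc[OF lim1] by simp
  have lim0: "r \<longlonglongrightarrow> 0" by (rule tendsto_0_if_Suc_times_tendsto_0[OF lim1])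
  have b_eq: "b = (c * (real (Suc n) * r n) - a * r n) - real (n + 2) * r (Suc n) * r n" for n
  proof -
    have "b = (- (real (n + 2) * G $ Suc (Suc n)) + c * (real (Suc n) * G $ Suc n) - a * G $ Suc n) / G $ n"
      using rec[of n] assms(2)[of n] by (simp add: field_simps)
    also have "\<dots> = (c * (real (Suc n) * r n) - a * r n) - real (n + 2) * r (Suc n) * r n"
      using assms(2)[of n] assms(2)[of "Suc n"] by (simp add: r_def diff_divide_distrib add_divide_distrib)
    finally show ?thesis .
  qed
  have "(\<lambda>n. (c * (real (Suc n) * r n) - a * r n) - real (n + 2) * r (Suc n) * r n) \<longlonglongrightarrow> (c * 0 - a * 0) - 0 * 0"
    by (intro tendsto_intros lim0 lim1 lim2)
  then have "b = 0" unfolding b_eq[symmetric] by (simp add: LIMSEQ_const_iff)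
  \<comment> \<open>The left-hand side grows by \<open>c\<close> in each step, while the right-hand side converges.\<close>
  have c_eq: "c * real (Suc n) = a + real (n + 2) * r (Suc n)" for n
    using rec[of n] assms(2)[of "Suc n"] \<open>b = 0\<close> by (simp add: r_def field_simps)
  have "(\<lambda>n. (a + real (Suc n + 2) * r (Suc (Suc n))) - (a + real (n + 2) * r (Suc n))) \<longlonglongrightarrow> (a + 0) - (a + 0)"
    by (intro tendsto_intros lim2 LIMSEQ_Suc[OF lim2])
  moreover have "(a + real (Suc n + 2) * r (Suc (Suc n))) - (a + real (n + 2) * r (Suc n)) = c" for n
    unfolding c_eq[symmetric] by (simp add: algebra_simps)
  ultimately show "c = 0" by (simp add: LIMSEQ_const_iff)
qed

text \<open>
  The Euler-Rayleigh estimates for the smallest zero \<open>d\<close>; \<open>S $ n\<close> is the power sum of exponent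
  \<open>n + 1\<close>. As \<open>S $ Suc n * d \<le> S $ n\<close> for all \<open>n\<close> with monotone ratios, equality at \<open>n = 1\<close> would persist
  for all larger \<open>n\<close> and make \<open>S\<close> geometric. The lower bounds come from the chain
  \<open>1 \<le> S $ 2 * d\<^sup>3 < S $ 1 * d\<^sup>2 < S $ 0 * d\<close>. Its first step is the third inequality of
  \<open>power_sum_bounds\<close>, and the others are the upper bounds.
\<close>
lemma power_sum_estimates:
  fixes G S :: "real fps" and d :: real
  assumes "S * G = - fps_deriv G" "\<And>n. G $ n \<noteq> 0"
    and "(\<lambda>n. real (Suc n) * (G $ Suc n / G $ n)) \<longlonglongrightarrow> 0"
    and "power_sum_bounds (fps_nth S)" "0 < S $ 0" "0 < S $ 1" "fps_conv_radius S = ereal d" "0 < d"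
  shows "S $ 1 * d < S $ 0" "S $ 2 * d < S $ 1" "1 < S $ 0 * d" "1 < S $ 1 * d\<^sup>2"
proof -
  note pos = power_sum_ratio_le(1)[OF assms(4-6)] and mono = power_sum_ratio_le(2)[OF assms(4-6)]
  have upper: "S $ Suc n * d \<le> S $ n" for n
    using conv_radius_power_sums_le[OF assms(4-6), of n] assms(7) pos[of "Suc n"]
    by (simp add: fps_conv_radius_def field_simps)
  have strict: "S $ 2 * d < S $ 1"
  proof (rule ccontr)
    assume "\<not> S $ 2 * d < S $ 1"
    then have "1 / d \<le> S $ Suc 1 / S $ 1"
      using assms(8) pos[of 1] by (simp add: field_simps numeral_2_eq_2)
    then have ge: "1 / d \<le> S $ Suc n / S $ n" if "1 \<le> n" for n
      using mono[OF that] by simp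
    have "S $ Suc n = 1 / d * S $ n" if "1 \<le> n" for n
    proof -
      have "S $ n \<le> S $ Suc n * d" using ge[OF that] assms(8) pos[of n] by (simp add: field_simps)
      then show ?thesis using upper[of n] assms(8) by (simp add: field_simps)
    qed
    then have "1 / d = 0" by (rule power_sums_not_geometric[OF assms(1-3)])
    then show False using assms(8) by simp
  qed
  show "S $ 2 * d < S $ 1" by (rule strict)
  have "S $ Suc 0 / S $ 0 \<le> S $ Suc 1 / S $ 1" by (rule mono) simp
  also have "\<dots> < 1 / d" using strict assms(8) pos[of 1] by (simp add: field_simps numeral_2_eq_2)
  finally show first: "S $ 1 * d < S $ 0" using assms(8) pos[of 0] by (simp add: field_simps)
  \<comment> \<open>The inequality \<open>s (Suc n) \<le> root 3 (s 2) * s n\<close> bounds the radius of convergence from below.\<close>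
  have "1 / root 3 (S $ 2) \<le> d"
    using conv_radius_power_sums_ge[OF assms(4)] pos[of 2] assms(7) by (simp add: fps_conv_radius_def)
  then have "1 \<le> root 3 (S $ 2) * d" using pos[of 2] by (simp add: field_simps)
  then have "1 \<le> (root 3 (S $ 2) * d) ^ 3" by (rule one_le_power)
  then have "1 \<le> S $ 2 * d ^ 3" using pos[of 2] by (simp add: power_mult_distrib)
  also have "\<dots> = S $ 2 * d * d\<^sup>2" by (simp add: power2_eq_square power3_eq_cube)
  also have "\<dots> < S $ 1 * d\<^sup>2" using strict assms(8) by (intro mult_strict_right_mono) auto
  finally show second: "1 < S $ 1 * d\<^sup>2" .
  also have "\<dots> = S $ 1 * d * d" by (simp add: power2_eq_square)
  also have "\<dots> < S $ 0 * d" using first assms(8) by simp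
  finally show "1 < S $ 0 * d" .
qed

section \<open>Growth and power sums of the Hahn-Exton series\<close>

lemma fps_conv_radius_ratio_0:
  fixes G :: "real fps"
  assumes "\<And>n. G $ n \<noteq> 0" "(\<lambda>n. G $ Suc n / G $ n) \<longlonglongrightarrow> 0"
  shows "fps_conv_radius G = \<infinity>"
  unfolding fps_conv_radius_def
proof (rule conv_radius_inftyI'')
  fix z :: real
  have "(\<lambda>n. norm (G $ Suc n / G $ n * z)) \<longlonglongrightarrow> norm (0 * z)"
    by (intro tendsto_intros assms(2))
  then have "eventually (\<lambda>n. norm (G $ Suc n / G $ n * z) < 1 / 2) sequentially"
    by (intro order_tendstoD) auto
  then obtain N where N: "\<And>n. n \<ge> N \<Longrightarrow> norm (G $ Suc n / G $ n * z) < 1 / 2"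
    unfolding eventually_sequentially by blast
  show "summable (\<lambda>n. G $ n * z ^ n)"
  proof (rule summable_ratio_test[where c = "1 / 2" and N = N])
    fix n assume "N \<le> n"
    have "G $ Suc n * z ^ Suc n = (G $ Suc n / G $ n * z) * (G $ n * z ^ n)"
      using assms(1)[of n] by simp
    then have "norm (G $ Suc n * z ^ Suc n) = norm (G $ Suc n / G $ n * z) * norm (G $ n * z ^ n)"
      by (simp only: norm_mult)
    then show "norm (G $ Suc n * z ^ Suc n) \<le> 1 / 2 * norm (G $ n * z ^ n)"
      using N[OF \<open>N \<le> n\<close>] by (simp only:) (intro mult_right_mono, auto)
  qed simp
qed

text \<open>
  The index is one less than the exponent: \<open>zero_power_sum A q 0\<close> is the sum of the reciprocal zeros.
\<close>
definition zero_power_sum :: "real \<Rightarrow> real \<Rightarrow> nat \<Rightarrow> real" where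
  "zero_power_sum A q = fps_nth (neg_log_deriv ((theta ^^ 2) (hahn_exton_fps A q)))"

context
  fixes A q :: real
  assumes A: "0 < A" "A < 1" and q: "0 < q" "q < 1"
begin

lemma theta_hahn_exton_nth_0: "(theta ^^ m) (hahn_exton_fps A q) $ 0 = 1"
  by (simp add: theta_funpow_nth hahn_exton_fps_def)

lemma theta_hahn_exton_nth_Suc:
  "(theta ^^ m) (hahn_exton_fps A q) $ Suc n =
   - (((2 * real n + 3) / (2 * real n + 1)) ^ m * q ^ Suc n / ((1 - q * q ^ n) * (1 - A * q ^ n)))
     * (theta ^^ m) (hahn_exton_fps A q) $ n"
proof -
  have e: "Suc n * (Suc n + 1) div 2 = n * (n + 1) div 2 + Suc n" by simp
  have "2 * real (Suc n) + 1 = (2 * real n + 3) / (2 * real n + 1) * (2 * real n + 1)"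
    by (simp add: field_simps)
  then show ?thesis
    unfolding theta_funpow_nth hahn_exton_fps_def fps_nth_Abs_fps e qpoch_Suc power_add
    by (simp only: power_mult_distrib) (simp add: mult_ac)
qed

lemma theta_hahn_exton_nonzero: "(theta ^^ m) (hahn_exton_fps A q) $ n \<noteq> 0"
  using qpoch_pos[OF A q, of n] qpoch_pos[of q q n] q
  by (simp add: theta_funpow_nth hahn_exton_fps_def)

text \<open>
  Successive coefficients have a quotient of order \<open>q\<^sup>n\<close>: this excludes geometric power sums, and it makes the
  series entire.
\<close>
lemma theta_hahn_exton_ratio:
  "(\<lambda>n. real (Suc n) * ((theta ^^ m) (hahn_exton_fps A q) $ Suc n / (theta ^^ m) (hahn_exton_fps A q) $ n))
     \<longlonglongrightarrow> 0"
proof -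
  have lim_q: "(\<lambda>n. q ^ n) \<longlonglongrightarrow> 0" using q by (intro LIMSEQ_power_zero) simp
  have "(\<lambda>n. real n * q ^ n) \<longlonglongrightarrow> 0"
    using q powser_times_n_limit_0[of q] by simp
  then have lim_nq: "(\<lambda>n. real (Suc n) * q ^ Suc n) \<longlonglongrightarrow> 0" by (rule LIMSEQ_Suc)
  have "(\<lambda>n. 2 / (2 * real n + 1)) \<longlonglongrightarrow> 0"
  proof -
    have "(\<lambda>n. 2 * inverse (real (Suc (2 * n)))) \<longlonglongrightarrow> 2 * 0"
      using LIMSEQ_subseq_LIMSEQ[OF LIMSEQ_inverse_real_of_nat, of "\<lambda>n. 2 * n"]
      by (intro tendsto_mult tendsto_const) (simp add: strict_mono_def o_def)
    then show ?thesis by (simp add: divide_inverse add.commute)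
  qed
  then have "(\<lambda>n. 1 + 2 / (2 * real n + 1)) \<longlonglongrightarrow> 1 + 0" by (intro tendsto_intros)
  then have lim_1: "(\<lambda>n. (2 * real n + 3) / (2 * real n + 1)) \<longlonglongrightarrow> 1"
    by (simp add: add_divide_distrib[symmetric] divide_simps) (simp add: divide_simps add.commute)
  have "(\<lambda>n. - (((2 * real n + 3) / (2 * real n + 1)) ^ m * (real (Suc n) * q ^ Suc n) /
      ((1 - q * q ^ n) * (1 - A * q ^ n)))) \<longlonglongrightarrow> - (1 ^ m * 0 / ((1 - q * 0) * (1 - A * 0)))"
    by (intro tendsto_intros lim_1 lim_nq lim_q) simp
  moreover have "real (Suc n) * ((theta ^^ m) (hahn_exton_fps A q) $ Suc n / (theta ^^ m) (hahn_exton_fps A q) $ n) =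
      - (((2 * real n + 3) / (2 * real n + 1)) ^ m * (real (Suc n) * q ^ Suc n) /
      ((1 - q * q ^ n) * (1 - A * q ^ n)))" for n
    unfolding theta_hahn_exton_nth_Suc using theta_hahn_exton_nonzero[of m n] by simp
  ultimately show ?thesis by simp
qed

lemma theta_hahn_exton_entire: "fps_conv_radius ((theta ^^ m) (hahn_exton_fps A q)) = \<infinity>"
  by (rule fps_conv_radius_ratio_0[OF theta_hahn_exton_nonzero
        tendsto_0_if_Suc_times_tendsto_0[OF theta_hahn_exton_ratio]])

text \<open>
  The first three Newton identities. The factors of the denominators are abbreviated by single letters, so that
  the verification is a polynomial identity in these letters. For \<open>A = q\<^sup>\<nu>\<^sup>+\<^sup>1\<close>, \<open>Y\<close> is \<open>Y_fun \<nu> q\<close> and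
  \<open>\<Phi>\<close> is \<open>theta_fun \<nu> q + phi_fun \<nu> q\<close>, arranged by the origin of the terms.
\<close>
lemma zero_power_sum_values:
  defines "Y \<equiv> 81 * A * q\<^sup>2 + 31 * A * q - 31 * q - 81"
    and "\<Phi> \<equiv> 49 * q ^ 3 * (1 - A)\<^sup>2 - 225 * q * (1 + q + q\<^sup>2) * (1 - A) * (1 - A * q\<^sup>2)
          + 243 * (1 + q) * (1 + q + q\<^sup>2) * (1 - A * q) * (1 - A * q\<^sup>2)"
  shows "zero_power_sum A q 0 = 9 * q / ((1 - q) * (1 - A))"
    and "zero_power_sum A q 1 = - (q\<^sup>2 * Y) / ((1 - q)\<^sup>2 * (1 + q) * (1 - A)\<^sup>2 * (1 - A * q))"
    and "zero_power_sum A q 2 = 3 * q ^ 3 * \<Phi> / ((1 - q) ^ 3 * (1 + q) * (1 + q + q\<^sup>2) * (1 - A) ^ 3 * (1 - A * q) * (1 - A * q\<^sup>2))"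
proof -
  define G where "G = (theta ^^ 2) (hahn_exton_fps A q)"
  define u where "u = 1 - q"
  define p where "p = 1 + q"
  define t where "t = 1 + q + q\<^sup>2"
  define v where "v = 1 - A"
  define w where "w = 1 - A * q"
  define x where "x = 1 - A * q\<^sup>2"
  have nz: "u \<noteq> 0" "p \<noteq> 0" "t \<noteq> 0" "v \<noteq> 0" "w \<noteq> 0" "x \<noteq> 0"
    using A q qpoch_factor_pos(1)[OF A q, of 1] qpoch_factor_pos(1)[OF A q, of 2]
    by (auto simp: u_def p_def t_def v_def w_def x_def add_pos_pos intro!: pos_add_strict less_imp_neq[THEN not_sym])
  have u2: "1 - q * q = u * p" and u3: "1 - q * q\<^sup>2 = u * t"
    by (simp_all add: u_def p_def t_def algebra_simps power2_eq_square)
  have G0: "G $ 0 = 1" by (simp add: G_def theta_hahn_exton_nth_0)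
  have G1: "G $ 1 = - (9 * q / (u * v))"
    using theta_hahn_exton_nth_Suc[of 2 0] G0 by (simp add: G_def u_def v_def)
  have G2: "G $ 2 = 25 * q ^ 3 / (u\<^sup>2 * p * v * w)"
    using theta_hahn_exton_nth_Suc[of 2 1] G1 nz
    by (simp add: G_def[symmetric] u2 w_def[symmetric] numeral_2_eq_2[symmetric] power_divide)
      (simp add: power2_eq_square power3_eq_cube mult_ac)
  have G3: "G $ 3 = - (49 * q ^ 6 / (u ^ 3 * p * t * v * w * x))"
    using theta_hahn_exton_nth_Suc[of 2 2] G2 nz
    by (simp add: G_def[symmetric] u3 x_def[symmetric] numeral_3_eq_3[symmetric] numeral_2_eq_2[symmetric] power_divide)
      (simp add: field_simps eval_nat_numeral)
  have s: "zero_power_sum A q n = - (real (Suc n) * G $ Suc n) - (\<Sum>i<n. zero_power_sum A q i * G $ (n - i))" for n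
    unfolding zero_power_sum_def G_def by (rule neg_log_deriv_nth[OF theta_hahn_exton_nth_0])
  have s0: "zero_power_sum A q 0 = 9 * q / (u * v)" using s[of 0] G1 by simp
  then show "zero_power_sum A q 0 = 9 * q / ((1 - q) * (1 - A))" by (simp add: u_def v_def)
  have "zero_power_sum A q 1 = - 2 * G $ 2 - zero_power_sum A q 0 * G $ 1"
    using s[of 1] by (simp add: numeral_2_eq_2)
  also have "\<dots> = q\<^sup>2 * (81 * p * w - 50 * q * v) / (u\<^sup>2 * p * v\<^sup>2 * w)"
    unfolding G1 G2 s0 using nz by (simp add: field_simps power2_eq_square power3_eq_cube)
  finally have s1: "zero_power_sum A q 1 = q\<^sup>2 * (81 * p * w - 50 * q * v) / (u\<^sup>2 * p * v\<^sup>2 * w)" .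
  have Y: "81 * p * w - 50 * q * v = - Y"
    by (simp add: Y_def p_def w_def v_def algebra_simps power2_eq_square)
  show "zero_power_sum A q 1 = - (q\<^sup>2 * Y) / ((1 - q)\<^sup>2 * (1 + q) * (1 - A)\<^sup>2 * (1 - A * q))"
    unfolding s1 Y unfolding u_def p_def v_def w_def by simp
  have "zero_power_sum A q 2 = - 3 * G $ 3 - (zero_power_sum A q 0 * G $ 2 + zero_power_sum A q 1 * G $ 1)"
    using s[of 2] by (simp add: numeral_2_eq_2 numeral_3_eq_3)
  also have "\<dots> = 3 * q ^ 3 * (49 * q ^ 3 * v\<^sup>2 - 225 * q * t * v * x + 243 * p * t * w * x)
      / (u ^ 3 * p * t * v ^ 3 * w * x)"
    unfolding G1 G2 G3 s0 s1 using nz by (simp add: field_simps eval_nat_numeral)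
  finally show "zero_power_sum A q 2 = 3 * q ^ 3 * \<Phi> / ((1 - q) ^ 3 * (1 + q) * (1 + q + q\<^sup>2) * (1 - A) ^ 3 * (1 - A * q) * (1 - A * q\<^sup>2))"
    unfolding \<Phi>_def u_def p_def t_def v_def w_def x_def .
qed

end

section \<open>The normalized function and the Bessel function\<close>

lemma has_field_derivative_theta:
  fixes U :: "complex fps"
  assumes "fps_conv_radius U = \<infinity>"
  shows "((\<lambda>z. z * eval_fps U (z\<^sup>2)) has_field_derivative eval_fps (theta U) (z\<^sup>2)) (at z)"
proof -
  have "(eval_fps U has_field_derivative eval_fps (fps_deriv U) (z\<^sup>2)) (at (z\<^sup>2))"
    using assms by (intro has_field_derivative_eval_fps) simp
  then have "((\<lambda>z. eval_fps U (z\<^sup>2)) has_field_derivative eval_fps (fps_deriv U) (z\<^sup>2) * (2 * z)) (at z)"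
    by (rule DERIV_chain2) (auto intro!: derivative_eq_intros)
  then have "((\<lambda>z. z * eval_fps U (z\<^sup>2)) has_field_derivative
      1 * eval_fps U (z\<^sup>2) + eval_fps (fps_deriv U) (z\<^sup>2) * (2 * z) * z) (at z)"
    by (rule DERIV_mult[OF DERIV_ident])
  then show ?thesis
    unfolding eval_fps_theta[OF assms] by (simp add: power2_eq_square algebra_simps)
qed

lemma second_deriv_theta:
  fixes U :: "complex fps"
  assumes "fps_conv_radius U = \<infinity>" "g = (\<lambda>z. z * eval_fps U (z\<^sup>2))"
  shows "deriv g = (\<lambda>z. eval_fps (theta U) (z\<^sup>2))"
    and "eval_fps (theta U) (z\<^sup>2) + z * deriv (deriv g) z = eval_fps (theta (theta U)) (z\<^sup>2)"
proof -
  show 1: "deriv g = (\<lambda>z. eval_fps (theta U) (z\<^sup>2))"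
    unfolding assms(2) using has_field_derivative_theta[OF assms(1)] by (intro ext DERIV_imp_deriv)
  have entire: "fps_conv_radius (theta U) = \<infinity>" using fps_conv_radius_theta[of U] assms(1) by simp
  have "(eval_fps (theta U) has_field_derivative eval_fps (fps_deriv (theta U)) (z\<^sup>2)) (at (z\<^sup>2))"
    using entire by (intro has_field_derivative_eval_fps) simp
  then have "((\<lambda>z. eval_fps (theta U) (z\<^sup>2)) has_field_derivative eval_fps (fps_deriv (theta U)) (z\<^sup>2) * (2 * z)) (at z)"
    by (rule DERIV_chain2) (auto intro!: derivative_eq_intros)
  then have "deriv (deriv g) z = eval_fps (fps_deriv (theta U)) (z\<^sup>2) * (2 * z)"
    unfolding 1 by (rule DERIV_imp_deriv)
  then show "eval_fps (theta U) (z\<^sup>2) + z * deriv (deriv g) z = eval_fps (theta (theta U)) (z\<^sup>2)"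
    unfolding eval_fps_theta[OF entire] by (simp add: power2_eq_square algebra_simps)
qed

text \<open>
  Differentiation acts on functions \<open>r\<^sup>\<mu> U(r\<^sup>2)\<close> by lowering \<open>\<mu>\<close> and applying \<open>\<mu> - 1 + theta\<close> to \<open>U\<close>.
\<close>
lemma has_real_derivative_powr_theta:
  fixes U :: "real fps"
  assumes "fps_conv_radius U = \<infinity>" "0 < r"
  shows "((\<lambda>r. r powr \<mu> * eval_fps U (r\<^sup>2)) has_real_derivative
    r powr (\<mu> - 1) * ((\<mu> - 1) * eval_fps U (r\<^sup>2) + eval_fps (theta U) (r\<^sup>2))) (at r)"
proof -
  have "(eval_fps U has_field_derivative eval_fps (fps_deriv U) (r\<^sup>2)) (at (r\<^sup>2))"
    using assms by (intro has_field_derivative_eval_fps) simp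
  then have 1: "((\<lambda>r. eval_fps U (r\<^sup>2)) has_field_derivative eval_fps (fps_deriv U) (r\<^sup>2) * (2 * r)) (at r)"
    by (rule DERIV_chain2) (auto intro!: derivative_eq_intros)
  have "((\<lambda>r. r powr \<mu>) has_real_derivative \<mu> * r powr (\<mu> - 1)) (at r)"
    using assms(2) by (rule has_real_derivative_powr)
  from DERIV_mult[OF this 1]
  have "((\<lambda>r. r powr \<mu> * eval_fps U (r\<^sup>2)) has_real_derivative
      \<mu> * r powr (\<mu> - 1) * eval_fps U (r\<^sup>2) + eval_fps (fps_deriv U) (r\<^sup>2) * (2 * r) * r powr \<mu>) (at r)" .
  moreover have "r powr \<mu> = r powr (\<mu> - 1) * r"
    using assms(2) by (simp add: powr_diff)
  ultimately show ?thesis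
    unfolding eval_fps_theta[OF assms(1)] by (simp add: power2_eq_square algebra_simps)
qed

text \<open>
  The differential operator is \<open>(r d/dr + 1 - \<nu>)\<^sup>2\<close>. On \<open>r\<^sup>\<nu> U(r\<^sup>2)\<close> the operator
  \<open>r d/dr + 1 - \<nu>\<close> acts as \<open>theta\<close> on \<open>U\<close>.
\<close>
lemma bessel_operator_powr:
  fixes U :: "real fps"
  assumes entire: "fps_conv_radius U = \<infinity>" and "0 < r"
    and J: "\<And>r. 0 < r \<Longrightarrow> J r = C * (r powr \<nu> * eval_fps U (r\<^sup>2))"
  shows "(1 - \<nu>)\<^sup>2 * J r + (3 - 2 * \<nu>) * r * deriv J r + r\<^sup>2 * deriv (deriv J) r =
    C * r powr \<nu> * eval_fps (theta (theta U)) (r\<^sup>2)"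
proof -
  have entire': "fps_conv_radius (theta U) = \<infinity>" using fps_conv_radius_theta[of U] entire by simp
  have D: "deriv J s = C * ((\<nu> - 1) * (s powr (\<nu> - 1) * eval_fps U (s\<^sup>2)) + s powr (\<nu> - 1) * eval_fps (theta U) (s\<^sup>2))"
    if "0 < s" for s
  proof -
    have "((\<lambda>r. C * (r powr \<nu> * eval_fps U (r\<^sup>2))) has_real_derivative
        C * (s powr (\<nu> - 1) * ((\<nu> - 1) * eval_fps U (s\<^sup>2) + eval_fps (theta U) (s\<^sup>2)))) (at s)"
      by (intro DERIV_cmult has_real_derivative_powr_theta entire that)
    then have "(J has_real_derivative
        C * (s powr (\<nu> - 1) * ((\<nu> - 1) * eval_fps U (s\<^sup>2) + eval_fps (theta U) (s\<^sup>2)))) (at s)"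
      by (rule has_field_derivative_transform_within_open[of _ _ _ "{0<..}"]) (use that J in auto)
    then show ?thesis by (simp add: DERIV_imp_deriv algebra_simps)
  qed
  have "((\<lambda>s. C * ((\<nu> - 1) * (s powr (\<nu> - 1) * eval_fps U (s\<^sup>2)) + s powr (\<nu> - 1) * eval_fps (theta U) (s\<^sup>2)))
      has_real_derivative
      C * ((\<nu> - 1) * (r powr (\<nu> - 1 - 1) * ((\<nu> - 1 - 1) * eval_fps U (r\<^sup>2) + eval_fps (theta U) (r\<^sup>2)))
        + r powr (\<nu> - 1 - 1) * ((\<nu> - 1 - 1) * eval_fps (theta U) (r\<^sup>2) + eval_fps (theta (theta U)) (r\<^sup>2)))) (at r)"
    by (intro DERIV_cmult DERIV_add has_real_derivative_powr_theta entire entire' assms(2))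
  then have "(deriv J has_real_derivative
      C * ((\<nu> - 1) * (r powr (\<nu> - 1 - 1) * ((\<nu> - 1 - 1) * eval_fps U (r\<^sup>2) + eval_fps (theta U) (r\<^sup>2)))
        + r powr (\<nu> - 1 - 1) * ((\<nu> - 1 - 1) * eval_fps (theta U) (r\<^sup>2) + eval_fps (theta (theta U)) (r\<^sup>2)))) (at r)"
    by (rule has_field_derivative_transform_within_open[of _ _ _ "{0<..}"]) (use assms(2) D in auto)
  then have D2: "deriv (deriv J) r =
      C * ((\<nu> - 1) * (r powr (\<nu> - 1 - 1) * ((\<nu> - 1 - 1) * eval_fps U (r\<^sup>2) + eval_fps (theta U) (r\<^sup>2)))
        + r powr (\<nu> - 1 - 1) * ((\<nu> - 1 - 1) * eval_fps (theta U) (r\<^sup>2) + eval_fps (theta (theta U)) (r\<^sup>2)))"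
    by (rule DERIV_imp_deriv)
  define P where "P = r powr (\<nu> - 1 - 1)"
  have P: "r powr (\<nu> - 1) = r * P" "r powr \<nu> = r * (r * P)"
    using assms(2) by (simp_all add: P_def powr_mult_base)
  show ?thesis
    unfolding D[OF assms(2)] D2 J[OF assms(2)] P_def[symmetric] P
    by (simp add: power2_eq_square algebra_simps)
qed

lemma hahn_exton_J_real:
  fixes r :: real
  assumes "0 < r" and entire: "fps_conv_radius (hahn_exton_fps (q powr (\<nu> + 1)) q) = \<infinity>"
  shows "hahn_exton_J \<nu> q r = qpoch_inf (q powr (\<nu> + 1)) q / qpoch_inf q q *
    (r powr \<nu> * eval_fps (hahn_exton_fps (q powr (\<nu> + 1)) q) (r\<^sup>2))"
proof -
  have "r powr (2 * real n + \<nu>) = r powr \<nu> * (r\<^sup>2) ^ n" for n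
  proof -
    have "r powr (2 * real n + \<nu>) = r powr \<nu> * r powr real (2 * n)"
      by (simp add: powr_add mult.commute)
    also have "r powr real (2 * n) = (r\<^sup>2) ^ n"
      using assms by (simp only: powr_realpow power_mult)
    finally show ?thesis .
  qed
  moreover have "summable (\<lambda>n. hahn_exton_fps (q powr (\<nu> + 1)) q $ n * (r\<^sup>2) ^ n)"
    using entire by (intro summable_fps) simp
  from suminf_mult[OF this, of "r powr \<nu>"]
  have "(\<Sum>n. r powr \<nu> * (hahn_exton_fps (q powr (\<nu> + 1)) q $ n * (r\<^sup>2) ^ n)) =
      r powr \<nu> * eval_fps (hahn_exton_fps (q powr (\<nu> + 1)) q) (r\<^sup>2)"
    by (simp add: eval_fps_def)
  ultimately show ?thesis
    unfolding hahn_exton_J_def by (simp add: hahn_exton_fps_def mult_ac)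
qed

lemma hahn_exton_g_eval:
  assumes "fps_conv_radius (hahn_exton_fps (q powr (\<nu> + 1)) q) = \<infinity>"
  shows "hahn_exton_g \<nu> q = (\<lambda>z. z * eval_fps (cfps (hahn_exton_fps (q powr (\<nu> + 1)) q)) (z\<^sup>2))"
proof
  fix z :: complex
  have pow: "z ^ (2 * n + 1) = z * (z\<^sup>2) ^ n" for n
    by (simp only: power_add power_mult power_one_right) (rule mult.commute)
  have "summable (\<lambda>n. cfps (hahn_exton_fps (q powr (\<nu> + 1)) q) $ n * (z\<^sup>2) ^ n)"
    using assms by (intro summable_fps) simp
  from suminf_mult[OF this, of z]
  show "hahn_exton_g \<nu> q z = z * eval_fps (cfps (hahn_exton_fps (q powr (\<nu> + 1)) q)) (z\<^sup>2)"
    unfolding hahn_exton_g_def eval_fps_def pow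
    by (simp add: hahn_exton_fps_def mult_ac)
qed

section \<open>The radius of convexity\<close>

text \<open>
  With \<open>w = z\<^sup>2\<close> the quotient \<open>1 + z g''/g'\<close> equals \<open>theta (theta F) / theta F\<close> at \<open>w\<close>. Its real part is
  positive for \<open>|w| < d\<close>, and at \<open>w = d\<close> the quotient vanishes or is undefined.
\<close>
lemma radius_of_convexity_eq_sqrt:
  fixes F :: "real fps" and d :: real
  assumes "fps_conv_radius F = \<infinity>" "F $ 0 = 1" "0 < d"
    and "\<And>n. 0 \<le> neg_log_deriv (theta F) $ n"
    and "eval_fps (theta (theta F)) d = 0"
    and "\<And>t. 0 \<le> t \<Longrightarrow> t < d \<Longrightarrow> eval_fps (theta (theta F)) t \<noteq> 0"
    and g: "g = (\<lambda>z. z * eval_fps (cfps F) (z\<^sup>2))"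
  shows "radius_of_convexity g = ereal (sqrt d)"
proof -
  let ?E = "eval_fps (cfps (theta F))" and ?D = "eval_fps (cfps (theta (theta F)))"
  have entire: "fps_conv_radius (theta F) = \<infinity>" "fps_conv_radius (theta (theta F)) = \<infinity>"
    using fps_conv_radius_theta[of F] fps_conv_radius_theta[of "theta F"] assms(1) by auto
  have E0: "theta F $ 0 = 1" using assms(2) by (simp add: theta_nth)
  have cF: "fps_conv_radius (cfps F) = \<infinity>" using assms(1) by simp
  have g1: "deriv g z = ?E (z\<^sup>2)" for z
    using second_deriv_theta(1)[OF cF g] by (simp add: cfps_theta)
  have g2: "1 + z * deriv (deriv g) z / deriv g z = ?D (z\<^sup>2) / ?E (z\<^sup>2)" if "?E (z\<^sup>2) \<noteq> 0" for z
  proof -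
    have "?E (z\<^sup>2) + z * deriv (deriv g) z = ?D (z\<^sup>2)"
      using second_deriv_theta(2)[OF cF g, of z] by (simp add: cfps_theta)
    then show ?thesis using that by (simp add: g1 field_simps)
  qed
  define X where "X = {r. r > 0 \<and> (\<forall>z. norm z < r \<longrightarrow>
            deriv g z \<noteq> 0 \<and> Re (1 + z * deriv (deriv g) z / deriv g z) > 0)}"
  have "sqrt d \<in> X"
    unfolding X_def
  proof (intro CollectI conjI allI impI)
    show "0 < sqrt d" using assms(3) by simp
    fix z :: complex assume "norm z < sqrt d"
    then have "(norm z)\<^sup>2 < (sqrt d)\<^sup>2" by (intro power_strict_mono) auto
    then have z: "norm (z\<^sup>2) < d" using assms(3) by (simp add: norm_power)
    note pos = theta_quotient_pos[OF entire(1) E0 neg_log_deriv_mult_self[OF E0] assms(4,6) z]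
    show "deriv g z \<noteq> 0" using pos(1) by (simp add: g1)
    show "0 < Re (1 + z * deriv (deriv g) z / deriv g z)"
      using pos(2) by (simp add: g2[OF pos(1)])
  qed
  moreover have "r \<le> sqrt d" if "r \<in> X" for r
  proof (rule ccontr)
    assume "\<not> r \<le> sqrt d"
    then have "norm (of_real (sqrt d) :: complex) < r" using assms(3) by simp
    with that have *: "?E ((of_real (sqrt d))\<^sup>2) \<noteq> 0"
      "0 < Re (1 + of_real (sqrt d) * deriv (deriv g) (of_real (sqrt d)) / deriv g (of_real (sqrt d)))"
      unfolding X_def by (auto simp: g1)
    have "(of_real (sqrt d))\<^sup>2 = (of_real d :: complex)"
      using assms(3) by (metis of_real_power real_sqrt_pow2 less_imp_le)
    moreover have "?D (of_real d) = 0"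
      using entire(2) assms(5) by (subst eval_cfps_of_real) auto
    ultimately show False using *(2) unfolding g2[OF *(1)] by simp
  qed
  ultimately show ?thesis
    unfolding radius_of_convexity_def X_def[symmetric]
    by (intro Sup_eqI) auto
qed

theorem theorem3:
  fixes \<nu> q :: real and J :: "real \<Rightarrow> real"
  defines "J \<equiv> hahn_exton_J \<nu> q"
  assumes "\<nu> > -1" and "0 < q" and "q < 1"
  shows "\<exists>r::real. radius_of_convexity (hahn_exton_g \<nu> q) = ereal r \<and>
    (0 < r \<and> (1 - \<nu>)\<^sup>2 * J r + (3 - 2 * \<nu>) * r * deriv J r + r\<^sup>2 * deriv (deriv J) r = 0 \<and>
      (\<forall>s. 0 < s \<and> (1 - \<nu>)\<^sup>2 * J s + (3 - 2 * \<nu>) * s * deriv J s + s\<^sup>2 * deriv (deriv J) s = 0 \<longrightarrow> r \<le> s)) \<and>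
    sqrt ((1 - q powr (\<nu> + 1)) * (1 - q) / (9 * q)) < r \<and>
    r < sqrt (9 * (q\<^sup>2 - 1) * (1 - q powr (\<nu> + 1)) * (1 - q powr (\<nu> + 2)) / (q * Y_fun \<nu> q)) \<and>
    root 4 ((1 + q) * (1 - q)\<^sup>2 * (1 - q powr (\<nu> + 1))\<^sup>2 * (q powr (\<nu> + 2) - 1) / (q\<^sup>2 * Y_fun \<nu> q)) < r \<and>
    r < sqrt ((1 - q powr (\<nu> + 1)) * (1 - q powr (\<nu> + 3)) * T_fun q * Y_fun \<nu> q /
              (3 * q * (q + 1) * (theta_fun \<nu> q + phi_fun \<nu> q)))"
proof -
  define A where "A = q powr (\<nu> + 1)"
  have A: "0 < A" "A < 1" using assms by (auto simp: A_def powr01_less_one)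
  note q = assms(3,4)
  define F where "F = hahn_exton_fps A q"
  define D where "D = theta (theta F)"
  have D_pow: "D = (theta ^^ 2) F" by (simp add: D_def numeral_2_eq_2)
  define S where "S = neg_log_deriv D"
  have entireF: "fps_conv_radius F = \<infinity>"
    using theta_hahn_exton_entire[OF A q, of 0] by (simp add: F_def)
  have F0: "F $ 0 = 1" using theta_hahn_exton_nth_0[OF A q, of 0] by (simp add: F_def)
  have entireD: "fps_conv_radius D = \<infinity>"
    unfolding D_pow F_def by (rule theta_hahn_exton_entire[OF A q])
  have D0: "D $ 0 = 1" unfolding D_pow F_def by (rule theta_hahn_exton_nth_0[OF A q])
  have log_deriv: "S * D = - fps_deriv D" unfolding S_def by (rule neg_log_deriv_mult_self[OF D0])
  have bounds: "power_sum_bounds (fps_nth S)"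
    unfolding S_def D_pow F_def by (rule power_sum_bounds_hahn_exton[OF A q])
  then have S_nonneg: "0 \<le> S $ n" for n by (simp add: power_sum_bounds_def)
  have S_power_sum: "S $ n = zero_power_sum A q n" for n by (simp add: S_def D_pow F_def zero_power_sum_def)

  define Y where "Y = 81 * A * q\<^sup>2 + 31 * A * q - 31 * q - 81"
  define \<Phi> where "\<Phi> = 49 * q ^ 3 * (1 - A)\<^sup>2 - 225 * q * (1 + q + q\<^sup>2) * (1 - A) * (1 - A * q\<^sup>2)
          + 243 * (1 + q) * (1 + q + q\<^sup>2) * (1 - A * q) * (1 - A * q\<^sup>2)"
  have pos: "0 < 1 - q" "0 < 1 + q" "0 < 1 + q + q\<^sup>2" "0 < 1 - A" "0 < 1 - A * q" "0 < 1 - A * q\<^sup>2"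
    using A q qpoch_factor_pos(1)[OF A q, of 1] qpoch_factor_pos(1)[OF A q, of 2]
    by (auto intro: add_pos_pos)
  have "- Y = 31 * q * (1 - A) + 81 * (1 - A * q\<^sup>2)" by (simp add: Y_def algebra_simps)
  then have Y_neg: "Y < 0" using pos q by (smt (verit) mult_pos_pos)
  have S0: "S $ 0 = 9 * q / ((1 - q) * (1 - A))"
    and S1: "S $ 1 = - (q\<^sup>2 * Y) / ((1 - q)\<^sup>2 * (1 + q) * (1 - A)\<^sup>2 * (1 - A * q))"
    and S2: "S $ 2 = 3 * q ^ 3 * \<Phi> / ((1 - q) ^ 3 * (1 + q) * (1 + q + q\<^sup>2) * (1 - A) ^ 3 * (1 - A * q) * (1 - A * q\<^sup>2))"
    using zero_power_sum_values[OF A q] by (simp_all add: S_power_sum Y_def \<Phi>_def)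
  have S0_pos: "0 < S $ 0" unfolding S0 using pos q by simp
  have S1_pos: "0 < S $ 1" unfolding S1 using pos q Y_neg
    by (intro divide_pos_pos mult_pos_pos) (auto simp: mult_pos_neg)
  have S2_pos: "0 < S $ 2" using power_sum_ratio_le(1)[OF bounds S0_pos S1_pos] .

  obtain d where d: "fps_conv_radius S = ereal d" "0 < d"
    using conv_radius_power_sums_le[OF bounds S0_pos S1_pos, of 0]
      log_deriv_conv_radius_pos[OF entireD D0 log_deriv S_nonneg]
    by (cases "fps_conv_radius S") (auto simp: fps_conv_radius_def)
  note estimates = power_sum_estimates[OF log_deriv _ _ bounds S0_pos S1_pos d,
      unfolded D_pow F_def, OF theta_hahn_exton_nonzero[OF A q] theta_hahn_exton_ratio[OF A q]]
  have D_real: "eval_fps (cfps D) (of_real t) = of_real (eval_fps D t)" for t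
    using entireD by (simp add: eval_cfps_of_real)
  have zero: "eval_fps D d = 0"
    using zero_at_radius[OF entireD D0 log_deriv S_nonneg d(1)] D_real by simp
  have nonzero: "eval_fps D t \<noteq> 0" if "0 \<le> t" "t < d" for t
    using nonzero_in_disc[OF entireD D0 log_deriv S_nonneg, of "of_real t"] d that D_real by auto

  have radius: "radius_of_convexity (hahn_exton_g \<nu> q) = ereal (sqrt d)"
  proof (rule radius_of_convexity_eq_sqrt[OF entireF F0 d(2)])
    show "0 \<le> neg_log_deriv (theta F) $ n" for n
      using power_sum_bounds_hahn_exton[OF A q, of 1] by (simp add: power_sum_bounds_def F_def)
    show "hahn_exton_g \<nu> q = (\<lambda>z. z * eval_fps (cfps F) (z\<^sup>2))"
      unfolding F_def A_def by (rule hahn_exton_g_eval) (use entireF in \<open>simp add: F_def A_def\<close>)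
  qed (use zero nonzero in \<open>simp_all add: D_def\<close>)

  define C where "C = qpoch_inf A q / qpoch_inf q q"
  have C: "C \<noteq> 0" unfolding C_def using qpoch_inf_nonzero[OF A q] qpoch_inf_nonzero[of q q] q by simp
  have root: "(1 - \<nu>)\<^sup>2 * J s + (3 - 2 * \<nu>) * s * deriv J s + s\<^sup>2 * deriv (deriv J) s = 0 \<longleftrightarrow>
      eval_fps D (s\<^sup>2) = 0" if "0 < s" for s
  proof -
    have "J r = C * (r powr \<nu> * eval_fps F (r\<^sup>2))" if "0 < r" for r
      unfolding J_def C_def F_def A_def using that entireF
      by (intro hahn_exton_J_real) (simp_all add: F_def A_def)
    from bessel_operator_powr[OF entireF that this] show ?thesis
      using C that by (simp add: D_def)
  qed
  have smallest: "sqrt d \<le> s" if "0 < s" "eval_fps D (s\<^sup>2) = 0" for s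
  proof -
    have "d \<le> s\<^sup>2" using nonzero[of "s\<^sup>2"] that by force
    then show ?thesis using that by (simp add: real_le_lsqrt)
  qed

  \<comment> \<open>From here on only rational expressions in \<open>A\<close> and \<open>q\<close> occur.\<close>
  have powr: "q powr (\<nu> + 2) = A * q" "q powr (\<nu> + 3) = A * q\<^sup>2" "q powr (\<nu> + 4) = A * q ^ 3"
    "q powr (\<nu> + 5) = A * q ^ 4" "q powr (\<nu> + 6) = A * q ^ 5" "q powr (2 * \<nu> + 5) = A\<^sup>2 * q ^ 3"
    "q powr (2 * \<nu> + 6) = A\<^sup>2 * q ^ 4" "q powr (2 * \<nu> + 7) = A\<^sup>2 * q ^ 5" "q powr (2 * \<nu> + 8) = A\<^sup>2 * q ^ 6"
  proof -
    have 1: "q powr (\<nu> + (1 + real n)) = A * q ^ n" for n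
      unfolding A_def using q by (simp add: powr_add powr_realpow)
    have 2: "q powr (2 * \<nu> + (2 + real n)) = A\<^sup>2 * q ^ n" for n
    proof -
      have "q powr (2 * \<nu> + (2 + real n)) = q powr ((\<nu> + 1) + (\<nu> + 1) + real n)"
        by (rule arg_cong[where f = "\<lambda>x. q powr x"]) simp
      then show ?thesis unfolding A_def using q by (simp only: powr_add powr_realpow power2_eq_square)
    qed
    show "q powr (\<nu> + 2) = A * q" "q powr (\<nu> + 3) = A * q\<^sup>2" "q powr (\<nu> + 4) = A * q ^ 3"
      "q powr (\<nu> + 5) = A * q ^ 4" "q powr (\<nu> + 6) = A * q ^ 5"
      using 1[of 1] 1[of 2] 1[of 3] 1[of 4] 1[of 5] by simp_all
    show "q powr (2 * \<nu> + 5) = A\<^sup>2 * q ^ 3" "q powr (2 * \<nu> + 6) = A\<^sup>2 * q ^ 4"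
      "q powr (2 * \<nu> + 7) = A\<^sup>2 * q ^ 5" "q powr (2 * \<nu> + 8) = A\<^sup>2 * q ^ 6"
      using 2[of 3] 2[of 4] 2[of 5] 2[of 6] by simp_all
  qed
  have Y: "Y_fun \<nu> q = Y" unfolding Y_fun_def powr Y_def by simp
  have \<Phi>: "theta_fun \<nu> q + phi_fun \<nu> q = \<Phi>"
    unfolding theta_fun_def phi_fun_def powr \<Phi>_def
    by (simp add: algebra_simps power2_eq_square power3_eq_cube eval_nat_numeral)
  have T: "T_fun q = - ((1 - q) * (1 + q) * (1 + q + q\<^sup>2))"
    by (simp add: T_fun_def algebra_simps eval_nat_numeral)
  have \<Phi>_nz: "\<Phi> \<noteq> 0" using S2_pos unfolding S2 by auto

  have b1: "(1 - A) * (1 - q) / (9 * q) = 1 / S $ 0"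
    unfolding S0 by (simp add: mult.commute)
  have b2: "9 * (q\<^sup>2 - 1) * (1 - A) * (1 - A * q) / (q * Y) = S $ 0 / S $ 1"
  proof -
    have "q\<^sup>2 - 1 = - ((1 - q) * (1 + q))" by (simp add: algebra_simps power2_eq_square)
    then show ?thesis unfolding S0 S1 using pos q Y_neg
      by (simp add: divide_simps power2_eq_square) 
  qed
  have b3: "(1 + q) * (1 - q)\<^sup>2 * (1 - A)\<^sup>2 * (A * q - 1) / (q\<^sup>2 * Y) = 1 / S $ 1"
    unfolding S1 using pos q Y_neg by (simp add: divide_simps) (simp add: algebra_simps)
  have b4: "(1 - A) * (1 - A * q\<^sup>2) * T_fun q * Y / (3 * q * (q + 1) * \<Phi>) = S $ 1 / S $ 2"
    unfolding S1 S2 T using pos q Y_neg \<Phi>_nz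
    by (simp add: divide_simps) (simp add: algebra_simps eval_nat_numeral)

  have "1 / S $ 0 < d" using estimates(3) S0_pos by (simp add: field_simps)
  then have 1: "sqrt (1 / S $ 0) < sqrt d" by simp
  have "d < S $ 0 / S $ 1" using estimates(1) S1_pos by (simp add: field_simps)
  then have 2: "sqrt d < sqrt (S $ 0 / S $ 1)" by simp
  have "1 / S $ 1 < d\<^sup>2" using estimates(4) S1_pos by (simp add: field_simps)
  also have "d\<^sup>2 = sqrt d ^ 4"
    using d(2) power_mult[of "sqrt d" 2 2] by simp
  finally have "root 4 (1 / S $ 1) < root 4 (sqrt d ^ 4)" by simp
  then have 3: "root 4 (1 / S $ 1) < sqrt d" using d(2) by (simp add: real_root_power_cancel)
  have "d < S $ 1 / S $ 2" using estimates(2) S2_pos by (simp add: field_simps)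
  then have 4: "sqrt d < sqrt (S $ 1 / S $ 2)" by simp

  have "(1 - \<nu>)\<^sup>2 * J (sqrt d) + (3 - 2 * \<nu>) * sqrt d * deriv J (sqrt d)
      + (sqrt d)\<^sup>2 * deriv (deriv J) (sqrt d) = 0"
    using root[of "sqrt d"] zero d(2) by simp
  then show ?thesis
    unfolding A_def[symmetric] powr Y \<Phi> b1 b2 b3 b4
    using radius root smallest d(2) 1 2 3 4
    by (intro exI[of _ "sqrt d"]) auto
qed

end
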